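(* Suppose $\rho$ is a real non-negative function with $\rho\in\mathrm{Lip}\,\lambda$, $\lambda>\alpha$, and let $M$ be its Hölder constant. Then (when $\inf\rho>0$, so that $\mu$ is defined) $$\operatorname{Re}(f,\mathfrak{D}^{\alpha}f)_{L_2(\Omega,\rho)}\ge\mu\|f\|^2_{L_2(\Omega,\rho)},\qquad f\in H^1_0(\Omega),$$ where $$\mu=\frac12\mathfrak{d}^{-\alpha}\Big(\frac1{\Gamma(1-\alpha)}+C^{(\alpha)}_n\Big)-\frac{\alpha M\mathfrak{d}^{\lambda-\alpha}}{2\Gamma(1-\alpha)(\lambda-\alpha)\inf\rho}.$$ Moreover, if in addition for every fixed direction $\mathbf{e}$ the function $\rho$ is monotonically non-increasing (i.e. $t\mapsto\rho(P+t\mathbf{e})$ is non-increasing on $[0,d(\mathbf{e})]$), then the same inequality holds with $$\mu=\frac12\mathfrak{d}^{-\alpha}\Big(\frac1{\Gamma(1-\alpha)}+C^{(\alpha)}_n\Big).$$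
   Context: Let $n\ge 2$, $\alpha\in(0,1)$, and let $\Omega\subset\mathbb{E}^n$ ($n$-dimensional Euclidean space) be a bounded convex domain with $\mathfrak{d}:=\operatorname{diam}\Omega$. Fix a point $P\in\partial\Omega$. A point $Q\in\Omega$ is written $Q=P+r\mathbf{e}$ with $r=|P-Q|$ and $\mathbf{e}$ the unit vector pointing from $P$ to $Q$; $d(\mathbf{e})$ is the length of the segment inside $\Omega$ of the ray from $P$ in direction $\mathbf{e}$. We write $T:=P+t\mathbf{e}$, $t\in\mathbb{R}$. Functions in $L_2(\Omega)$, $H_0^1(\Omega)$ are complex-valued. The Kipriyanov fractional differential operator is $$(\mathfrak{D}^{\alpha}f)(Q)=\frac{\alpha}{\Gamma(1-\alpha)}\int_0^r\frac{f(Q)-f(T)}{(r-t)^{\alpha+1}}\Big(\frac tr\Big)^{n-1}dt+C^{(\alpha)}_n f(Q)r^{-\alpha},\qquad C^{(\alpha)}_n=\frac{(n-1)!}{\Gamma(n-\alpha)}.$$ For $0<\lambda\le1$, $\mathrm{Lip}\,\lambda$ is the set of functions $\rho$ on $\bar\Omega$ for which there is a constant $M$ (Hölder constant) with $|\rho(Q_1)-\rho(Q_2)|\le M|Q_1-Q_2|^{\lambda}$ for all $Q_1,Q_2\in\bar\Omega$. $L_2(\Omega,\rho)$ is the weighted space with $(f,g)_{L_2(\Omega,\rho)}=\int_\Omega f\,\overline{g}\,\rho\,dQ$. *)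

theory Defs
  imports "HOL-Analysis.Analysis"
begin

definition partial_deriv :: "'a::euclidean_space \<Rightarrow> ('a \<Rightarrow> complex) \<Rightarrow> 'a \<Rightarrow> complex" where
  "partial_deriv i \<phi> x = frechet_derivative \<phi> (at x) i"

primrec Ck :: "nat \<Rightarrow> ('a::euclidean_space \<Rightarrow> complex) \<Rightarrow> bool" where
  "Ck 0 \<phi> \<longleftrightarrow> continuous_on UNIV \<phi>"
| "Ck (Suc k) \<phi> \<longleftrightarrow> (\<forall>x. \<phi> differentiable (at x)) \<and> (\<forall>i\<in>Basis. Ck k (partial_deriv i \<phi>))"

text \<open>Functions in \<open>C\<^sub>c\<^sup>\<infinity>(\<Omega>)\<close>, extended by zero to the whole space.\<close>

definition test_functions :: "'a::euclidean_space set \<Rightarrow> ('a \<Rightarrow> complex) set" where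
  "test_functions \<Omega> =
     {\<phi>. (\<forall>k. Ck k \<phi>) \<and> compact (closure {x. \<phi> x \<noteq> 0}) \<and> closure {x. \<phi> x \<noteq> 0} \<subseteq> \<Omega>}"

text \<open>Elements of \<open>L\<^sub>2(\<Omega>)\<close> and \<open>H\<^sub>0\<^sup>1(\<Omega>)\<close> are represented by functions on the whole space whose
  values outside \<open>\<Omega>\<close> are irrelevant; every representative of an almost-everywhere class
  is admitted.\<close>

definition L2 :: "'a::euclidean_space set \<Rightarrow> ('a \<Rightarrow> complex) set" where
  "L2 \<Omega> = {f. set_borel_measurable lebesgue \<Omega> f \<and>
              set_integrable lebesgue \<Omega> (\<lambda>x. (norm (f x))\<^sup>2)}"

definition weak_gradient ::
  "'a::euclidean_space set \<Rightarrow> ('a \<Rightarrow> complex) \<Rightarrow> ('a \<Rightarrow> 'a \<Rightarrow> complex) \<Rightarrow> bool" where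
  "weak_gradient \<Omega> f g \<longleftrightarrow>
     (\<forall>i\<in>Basis. g i \<in> L2 \<Omega> \<and>
        (\<forall>\<phi>\<in>test_functions \<Omega>.
           (LINT x:\<Omega>|lebesgue. f x * partial_deriv i \<phi> x) = - (LINT x:\<Omega>|lebesgue. g i x * \<phi> x)))"

text \<open>The \<open>H\<^sup>1(\<Omega>)\<close> norm of a function \<open>u\<close> whose weak partial derivative in direction \<open>i \<in> Basis\<close>
  is \<open>v i\<close>.\<close>

definition H1_norm ::
  "'a::euclidean_space set \<Rightarrow> ('a \<Rightarrow> complex) \<Rightarrow> ('a \<Rightarrow> 'a \<Rightarrow> complex) \<Rightarrow> real" where
  "H1_norm \<Omega> u v =
     sqrt ((LINT x:\<Omega>|lebesgue. (norm (u x))\<^sup>2) +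
           (\<Sum>i\<in>Basis. LINT x:\<Omega>|lebesgue. (norm (v i x))\<^sup>2))"

text \<open>\<open>H\<^sub>0\<^sup>1(\<Omega>)\<close> is the closure of \<open>C\<^sub>c\<^sup>\<infinity>(\<Omega>)\<close> in \<open>H\<^sup>1(\<Omega>)\<close>; the weak gradient \<open>g\<close> is unique up to
  null sets.\<close>

definition H10 :: "'a::euclidean_space set \<Rightarrow> ('a \<Rightarrow> complex) set" where
  "H10 \<Omega> = {f \<in> L2 \<Omega>. \<exists>g. weak_gradient \<Omega> f g \<and>
     (\<forall>\<epsilon>>0. \<exists>\<phi>\<in>test_functions \<Omega>.
        H1_norm \<Omega> (\<lambda>x. f x - \<phi> x) (\<lambda>i x. g i x - partial_deriv i \<phi> x) < \<epsilon>)}"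

definition kipriyanov_const :: "nat \<Rightarrow> real \<Rightarrow> real" where
  "kipriyanov_const n \<alpha> = fact (n - 1) / Gamma (real n - \<alpha>)"

definition kipriyanov ::
  "'a::euclidean_space \<Rightarrow> real \<Rightarrow> ('a \<Rightarrow> complex) \<Rightarrow> 'a \<Rightarrow> complex" where
  "kipriyanov P \<alpha> f Q =
     (let n = DIM('a); r = dist P Q; e = (Q - P) /\<^sub>R r in
        of_real (\<alpha> / Gamma (1 - \<alpha>)) *
          (LINT t:{0..r}|lebesgue.
             (f Q - f (P + t *\<^sub>R e)) / of_real ((r - t) powr (\<alpha> + 1)) * of_real ((t / r) ^ (n - 1)))
        + of_real (kipriyanov_const n \<alpha>) * f Q * of_real (r powr (- \<alpha>)))"

definition holder_with :: "'a::metric_space set \<Rightarrow> real \<Rightarrow> real \<Rightarrow> ('a \<Rightarrow> real) \<Rightarrow> bool" where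
  "holder_with S \<beta> M \<rho> \<longleftrightarrow> (\<forall>x\<in>S. \<forall>y\<in>S. \<bar>\<rho> x - \<rho> y\<bar> \<le> M * dist x y powr \<beta>)"

definition weighted_inner ::
  "'a::euclidean_space set \<Rightarrow> ('a \<Rightarrow> real) \<Rightarrow> ('a \<Rightarrow> complex) \<Rightarrow> ('a \<Rightarrow> complex) \<Rightarrow> complex" where
  "weighted_inner \<Omega> \<rho> f g = (LINT Q:\<Omega>|lebesgue. f Q * cnj (g Q) * of_real (\<rho> Q))"

definition weighted_norm :: "'a::euclidean_space set \<Rightarrow> ('a \<Rightarrow> real) \<Rightarrow> ('a \<Rightarrow> complex) \<Rightarrow> real" where
  "weighted_norm \<Omega> \<rho> f = sqrt (Re (weighted_inner \<Omega> \<rho> f f))"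

text \<open>The length is \<open>0\<close> for directions whose ray does not meet \<open>\<Omega>\<close>.\<close>

definition ray_length :: "'a::euclidean_space set \<Rightarrow> 'a \<Rightarrow> 'a \<Rightarrow> real" where
  "ray_length \<Omega> P e = measure lebesgue {t. 0 \<le> t \<and> P + t *\<^sub>R e \<in> \<Omega>}"

end

theory Submission
  imports Defs
begin

text \<open>Substituting \<open>t = r s\<close> and translating \<open>P\<close> to the origin, the operator at a point \<open>y\<close> becomes
  \<open>\<bar>y\<bar>\<^sup>-\<^sup>\<alpha>\<close> times \<open>\<alpha> / \<Gamma>(1 - \<alpha>) \<integral>\<^sub>0\<^sup>1 (f(y) - f(s y)) (1 - s)\<^sup>-\<^sup>\<alpha>\<^sup>-\<^sup>1 s\<^sup>n\<^sup>-\<^sup>1 ds + C f(y)\<close>, so that polar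
  coordinates can be replaced by the dilations \<open>y \<mapsto> s y\<close>, which scale Lebesgue measure by a
  constant. The pointwise inequality
  \<open>Re (f(y) cnj (f(y) - f(s y))) \<ge> (\<bar>f(y)\<bar>\<^sup>2 - \<bar>f(s y)\<bar>\<^sup>2) / 2\<close> and a change of variables in the second
  term leave only one-dimensional kernel integrals. Since the two terms are not integrable
  separately up to \<open>s = 1\<close>, the integral is first cut off at \<open>s \<le> h < 1\<close>.
  Absolute convergence for \<open>f\<close> in \<open>H\<^sub>0\<^sup>1(\<Omega>)\<close> follows from a Hardy inequality and a bound on
  \<open>f(y) - f(s y)\<close> by the gradient, both passed on from test functions by Fatou's lemma.\<close>

section \<open>Dilations of Lebesgue measure\<close>

text \<open>The constants in mu measure how far the two terms fail to cancel. With n the dimension,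
  the first carries the kernel \<open>(1-s)^(-\<alpha>-1) s^(n-1)\<close>; in the second, y = s x
  turns it into \<open>(1-s)^(-\<alpha>-1) s^(\<alpha>-1)\<close>. Cut off at h, both masses grow
  like (1-h)^(-\<alpha>)/\<alpha>. In the limit the first falls short of this by at most a Beta
  integral which, times \<alpha>/Gamma(1-\<alpha>), is exactly \<open>kipriyanov_const\<close>: half
  of the zero-order term pays for it and the other half gives one summand of mu. The other summand
  comes from the support: a contribution needs y/s in the domain, hence s \<ge> |y|/d with d the
  diameter, and the part of the second mass below that s is at least (|y|/d)^\<alpha>/\<alpha>,
  whose |y|^\<alpha> cancels the weight |y|^(-\<alpha>). Comparing \<rho>(y/s) with \<rho>(y) costs
  (|y| (1-s)/s)^\<beta>, integrable against the kernel near s = 1 because \<beta> > \<alpha>. That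
  error carries no factor \<rho>, whence the infimum in the denominator; if \<rho> decreases along
  rays, the error is absent.\<close>

lemma nn_integral_lborel_scaleR:
  fixes g :: "'a::euclidean_space \<Rightarrow> ennreal"
  assumes [measurable]: "g \<in> borel_measurable borel" and s: "0 < s"
  shows "(\<integral>\<^sup>+x. g x \<partial>lborel) = ennreal (s ^ DIM('a)) * (\<integral>\<^sup>+x. g (s *\<^sub>R x) \<partial>lborel)"
  using s
  by (subst lborel_affine[of s "0::'a"])
     (simp_all add: nn_integral_density nn_integral_distr nn_integral_cmult)

lemma nn_integral_lborel_scaleR':
  fixes g :: "'a::euclidean_space \<Rightarrow> ennreal"
  assumes [measurable]: "g \<in> borel_measurable borel" and s: "0 < s"
  shows "(\<integral>\<^sup>+x. g (s *\<^sub>R x) \<partial>lborel) = ennreal (s powr (- real DIM('a))) * (\<integral>\<^sup>+x. g x \<partial>lborel)"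
proof -
  have "s powr (- real DIM('a)) * s ^ DIM('a) = 1"
    using s by (simp flip: powr_realpow powr_add)
  then show ?thesis
    using s by (subst nn_integral_lborel_scaleR[OF assms])
      (simp add: mult.assoc[symmetric] ennreal_mult'[symmetric])
qed

lemma AE_lborel_scaleR:
  fixes P :: "'a::euclidean_space \<Rightarrow> bool"
  assumes "AE x in lborel. P x" and s: "0 < s"
  shows "AE x in lborel. P (s *\<^sub>R x)"
proof -
  obtain N where N: "N \<in> null_sets lborel" "{x. \<not> P x} \<subseteq> N"
    using assms(1) by (auto elim!: AE_E simp: null_sets_def)
  then have [measurable]: "N \<in> sets borel" by auto
  have "(\<integral>\<^sup>+x. indicator N (s *\<^sub>R x) \<partial>(lborel :: 'a measure)) = 0"
    using N(1) s by (subst nn_integral_lborel_scaleR') (auto simp: null_sets_def)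
  then have "AE x in lborel. (indicator N (s *\<^sub>R x) :: ennreal) = 0"
    by (subst (asm) nn_integral_0_iff_AE) auto
  then show ?thesis
    by eventually_elim (use N(2) in \<open>auto simp: indicator_def split: if_splits\<close>)
qed

section \<open>Differences along rays and a Hardy inequality\<close>

text \<open>\<open>v\<close> stands for the squared gradient length. Integrating \<open>seg\<close>
  over x and substituting y = \<tau> x produces the power \<tau>^(\<alpha>-n-2), which is largest at
  \<tau> = s. One factor 1 - s is already in \<open>seg\<close>, the other is the length of the
  \<tau>-interval; the root 1 - s of their product is what makes the kernel (1-s)^(-\<alpha>-1)
  integrable at 1.\<close>

lemma nn_integral_dilation_difference:
  fixes u :: "'a::euclidean_space \<Rightarrow> complex" and v :: "'a \<Rightarrow> real"
  assumes u: "continuous_on UNIV u" and v: "continuous_on UNIV v" and vnn: "\<And>x. 0 \<le> v x"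
    and s: "0 < s" "s < 1" and \<alpha>: "0 < \<alpha>" "\<alpha> < 1"
    and vD: "\<And>x. D < norm x \<Longrightarrow> v x = 0"
    and seg: "\<And>x. ennreal ((norm (u x - u (s *\<^sub>R x)))\<^sup>2)
        \<le> ennreal ((1 - s) * (norm x)\<^sup>2) * (\<integral>\<^sup>+\<tau>\<in>{s..1}. ennreal (v (\<tau> *\<^sub>R x)) \<partial>lborel)"
  shows "(\<integral>\<^sup>+x. ennreal (norm x powr (- \<alpha>) * (norm (u x - u (s *\<^sub>R x)))\<^sup>2) \<partial>lborel)
    \<le> ennreal ((1 - s)\<^sup>2 * s powr (\<alpha> - real DIM('a) - 2) * D powr (2 - \<alpha>)) * (\<integral>\<^sup>+x. ennreal (v x) \<partial>lborel)"
    (is "?L \<le> ?R")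
proof -
  have [measurable]: "u \<in> borel_measurable borel" "v \<in> borel_measurable borel"
    using u v by (auto intro: borel_measurable_continuous_onI)
  let ?V = "\<integral>\<^sup>+x. ennreal (v x) \<partial>lborel"
  have "?L \<le> (\<integral>\<^sup>+x. \<integral>\<^sup>+\<tau>. ennreal ((1 - s) * norm x powr (2 - \<alpha>)) * ennreal (v (\<tau> *\<^sub>R x)) * indicator {s..1} \<tau> \<partial>lborel \<partial>lborel)"
  proof (rule nn_integral_mono)
    fix x :: 'a
    have "norm x powr (- \<alpha>) * (norm x)\<^sup>2 = norm x powr (2 - \<alpha>)"
      by (cases "x = 0") (simp_all add: powr_diff powr_minus field_simps powr_numeral)
    then have e: "ennreal (norm x powr (- \<alpha>)) * ennreal ((1 - s) * (norm x)\<^sup>2) = ennreal ((1 - s) * norm x powr (2 - \<alpha>))"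
      using s by (simp add: ennreal_mult'[symmetric] mult_ac)
    have "ennreal (norm x powr (- \<alpha>) * (norm (u x - u (s *\<^sub>R x)))\<^sup>2)
      \<le> ennreal (norm x powr (- \<alpha>)) * (ennreal ((1 - s) * (norm x)\<^sup>2) * (\<integral>\<^sup>+\<tau>\<in>{s..1}. ennreal (v (\<tau> *\<^sub>R x)) \<partial>lborel))"
      by (subst ennreal_mult) (auto intro!: mult_left_mono seg)
    also have "\<dots> = (\<integral>\<^sup>+\<tau>. ennreal ((1 - s) * norm x powr (2 - \<alpha>)) * ennreal (v (\<tau> *\<^sub>R x)) * indicator {s..1} \<tau> \<partial>lborel)"
      unfolding mult.assoc[symmetric] e by (subst nn_integral_cmult[symmetric]) (auto simp: mult.assoc)
    finally show "ennreal (norm x powr (- \<alpha>) * (norm (u x - u (s *\<^sub>R x)))\<^sup>2) \<le> \<dots>" .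
  qed
  also have "\<dots> = (\<integral>\<^sup>+\<tau>. \<integral>\<^sup>+x. ennreal ((1 - s) * norm x powr (2 - \<alpha>)) * ennreal (v (\<tau> *\<^sub>R x)) * indicator {s..1} \<tau> \<partial>lborel \<partial>lborel)"
    by (rule lborel_pair.Fubini'[symmetric]) measurable
  also have "\<dots> \<le> (\<integral>\<^sup>+\<tau>. ennreal ((1 - s) * s powr (\<alpha> - real DIM('a) - 2) * D powr (2 - \<alpha>)) * ?V * indicator {s..1} \<tau> \<partial>lborel)"
  proof (rule nn_integral_mono)
    fix \<tau> :: real
    show "(\<integral>\<^sup>+x. ennreal ((1 - s) * norm x powr (2 - \<alpha>)) * ennreal (v (\<tau> *\<^sub>R x)) * indicator {s..1} \<tau> \<partial>lborel)
       \<le> ennreal ((1 - s) * s powr (\<alpha> - real DIM('a) - 2) * D powr (2 - \<alpha>)) * ?V * indicator {s..1} \<tau>"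
    proof (cases "\<tau> \<in> {s..1}")
      case True
      then have \<tau>: "0 < \<tau>" "s \<le> \<tau>" using s by auto
      have "norm x powr (2 - \<alpha>) = \<tau> powr (\<alpha> - 2) * norm (\<tau> *\<^sub>R x) powr (2 - \<alpha>)" for x :: 'a
        using \<tau> by (simp add: powr_mult mult.assoc[symmetric] powr_add[symmetric])
      then have "(\<integral>\<^sup>+x. ennreal ((1 - s) * norm x powr (2 - \<alpha>)) * ennreal (v (\<tau> *\<^sub>R x)) \<partial>lborel)
         = (\<integral>\<^sup>+x. ennreal ((1 - s) * (\<tau> powr (\<alpha> - 2) * norm (\<tau> *\<^sub>R x) powr (2 - \<alpha>))) * ennreal (v (\<tau> *\<^sub>R x)) \<partial>lborel)"
        by simp
      also have "\<dots> = ennreal (\<tau> powr (- real DIM('a))) * (\<integral>\<^sup>+x. ennreal ((1 - s) * (\<tau> powr (\<alpha> - 2) * norm x powr (2 - \<alpha>))) * ennreal (v x) \<partial>lborel)"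
        by (rule nn_integral_lborel_scaleR'[OF _ \<tau>(1), where g="\<lambda>x. ennreal ((1 - s) * (\<tau> powr (\<alpha> - 2) * norm x powr (2 - \<alpha>))) * ennreal (v x)"]) measurable
      also have "\<dots> \<le> ennreal (\<tau> powr (- real DIM('a))) * (\<integral>\<^sup>+x. ennreal ((1 - s) * (\<tau> powr (\<alpha> - 2) * D powr (2 - \<alpha>))) * ennreal (v x) \<partial>lborel)"
      proof (intro mult_left_mono nn_integral_mono)
        fix x :: 'a
        show "ennreal ((1 - s) * (\<tau> powr (\<alpha> - 2) * norm x powr (2 - \<alpha>))) * ennreal (v x) 
           \<le> ennreal ((1 - s) * (\<tau> powr (\<alpha> - 2) * D powr (2 - \<alpha>))) * ennreal (v x)"
          using s \<alpha> vD[of x]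
          by (cases "D < norm x") (auto intro!: mult_right_mono ennreal_leI mult_left_mono powr_mono2)
      qed simp
      also have "\<dots> = ennreal (\<tau> powr (\<alpha> - real DIM('a) - 2)) * ennreal ((1 - s) * D powr (2 - \<alpha>)) * ?V"
      proof -
        have "\<tau> powr (- real DIM('a)) * ((1 - s) * (\<tau> powr (\<alpha> - 2) * D powr (2 - \<alpha>)))
          = (\<tau> powr (- real DIM('a)) * \<tau> powr (\<alpha> - 2)) * ((1 - s) * D powr (2 - \<alpha>))" by simp
        also have "\<dots> = \<tau> powr (\<alpha> - real DIM('a) - 2) * ((1 - s) * D powr (2 - \<alpha>))"
          unfolding powr_add[symmetric] by (simp add: algebra_simps)
        finally have e: "\<tau> powr (- real DIM('a)) * ((1 - s) * (\<tau> powr (\<alpha> - 2) * D powr (2 - \<alpha>))) = \<dots>" .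
        show ?thesis
          using s by (subst nn_integral_cmult)
            (simp_all del: mult_cancel_right mult_cancel_left add: mult.assoc[symmetric] ennreal_mult'[symmetric] e[unfolded mult.assoc[symmetric]])
      qed
      also have "\<dots> \<le> ennreal (s powr (\<alpha> - real DIM('a) - 2)) * ennreal ((1 - s) * D powr (2 - \<alpha>)) * ?V"
        using s \<tau> \<alpha> by (intro mult_right_mono ennreal_leI powr_mono2') auto
      finally show ?thesis using True s by (simp add: ennreal_mult'[symmetric] mult_ac)
    qed simp
  qed
  also have "\<dots> = ennreal ((1 - s) * s powr (\<alpha> - real DIM('a) - 2) * D powr (2 - \<alpha>)) * ?V * ennreal (1 - s)"
    using s by (subst nn_integral_cmult_indicator) auto
  also have "\<dots> = ennreal ((1 - s) * s powr (\<alpha> - real DIM('a) - 2) * D powr (2 - \<alpha>)) * ennreal (1 - s) * ?V"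
    by (simp only: mult_ac)
  also have "\<dots> = ?R"
    using s by (subst ennreal_mult''[symmetric]) (simp_all add: power2_eq_square mult_ac)
  finally show ?thesis .
qed

lemma nn_integral_le_AE_limit:
  fixes h :: "'a \<Rightarrow> ennreal"
  assumes [measurable]: "\<And>k. H k \<in> borel_measurable M"
    and lim: "AE x in M. (\<lambda>k. H k x) \<longlonglongrightarrow> h x"
    and le: "\<And>k::nat. (\<integral>\<^sup>+x. H k x \<partial>M) \<le> C"
  shows "(\<integral>\<^sup>+x. h x \<partial>M) \<le> C"
proof -
  have "(\<integral>\<^sup>+x. h x \<partial>M) = (\<integral>\<^sup>+x. liminf (\<lambda>k. H k x) \<partial>M)"
    using lim by (intro nn_integral_cong_AE) (auto elim!: eventually_mono simp: lim_imp_Liminf)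
  also have "\<dots> \<le> liminf (\<lambda>k. \<integral>\<^sup>+x. H k x \<partial>M)"
    by (rule nn_integral_liminf) simp
  also have "\<dots> \<le> C"
    using le by (intro Liminf_le) auto
  finally show ?thesis .
qed

text \<open>Comparing \<open>u\<close> with its dilate by the factor \<open>1/2\<close>: the squared weighted norm of the dilate
  is \<open>2\<^sup>n\<^sup>-\<^sup>\<alpha> > 2\<close> times that of \<open>u\<close>, so the latter can be absorbed.\<close>

lemma nn_integral_Hardy_le:
  fixes u :: "'a::euclidean_space \<Rightarrow> complex" and v :: "'a \<Rightarrow> real"
  assumes n: "2 \<le> DIM('a)"
    and u: "continuous_on UNIV u" and v: "continuous_on UNIV v" and vnn: "\<And>x. 0 \<le> v x"
    and \<alpha>: "0 < \<alpha>" "\<alpha> < 1"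
    and vD: "\<And>x. D < norm x \<Longrightarrow> v x = 0"
    and uD: "\<And>x. D < norm x \<Longrightarrow> u x = 0"
    and u0: "0 < \<delta>" "\<And>x. norm x < \<delta> \<Longrightarrow> u x = 0"
    and seg: "\<And>x s. 0 < s \<Longrightarrow> s < 1 \<Longrightarrow> ennreal ((norm (u x - u (s *\<^sub>R x)))\<^sup>2)
        \<le> ennreal ((1 - s) * (norm x)\<^sup>2) * (\<integral>\<^sup>+\<tau>\<in>{s..1}. ennreal (v (\<tau> *\<^sub>R x)) \<partial>lborel)"
    and G: "(\<integral>\<^sup>+x. ennreal (v x) \<partial>lborel) \<le> ennreal G" "0 \<le> G"
  shows "(\<integral>\<^sup>+x. ennreal (norm x powr (- \<alpha>) * (norm (u x))\<^sup>2) \<partial>lborel)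
    \<le> ennreal (2 * (2 powr (real DIM('a) - \<alpha>) * D powr (2 - \<alpha>) * G) / (2 powr (real DIM('a) - \<alpha>) - 2))"
proof -
  have [measurable]: "u \<in> borel_measurable borel"
    using u by (auto intro: borel_measurable_continuous_onI)
  define q where "q = 2 powr (real DIM('a) - \<alpha>)"
  \<comment> \<open>\<open>q\<close> is the dilation ratio. It has to beat the factor 2 from the
    squared triangle inequality below; n \<ge> 2 and \<alpha> < 1 put the exponent n - \<alpha>
    above 1.\<close>
  have q: "2 < q"
  proof -
    have "2 powr 1 < (2::real) powr (real DIM('a) - \<alpha>)"
      using n \<alpha> by (intro powr_less_mono) auto
    then show ?thesis by (simp add: q_def)
  qed
  have half: "(1/2) powr y = (2::real) powr (- y)" for y
    by (simp add: powr_divide powr_minus_divide)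
  let ?N = "\<integral>\<^sup>+x. ennreal (norm x powr (- \<alpha>) * (norm (u x))\<^sup>2) \<partial>lborel"
  have "bounded (u ` cball 0 D)"
    by (intro compact_imp_bounded compact_continuous_image continuous_on_subset[OF u] compact_cball) simp
  then obtain B where B: "\<And>x. x \<in> cball 0 D \<Longrightarrow> norm (u x) \<le> B"
    unfolding bounded_iff by blast
  \<comment> \<open>A priori finiteness: u is bounded, and it vanishes off the ball of radius D and
    within \<delta> of the origin, where the weight is singular. Only a finite \<open>N\<close> can
    be subtracted when the final inequality is solved for it.\<close>
  have "?N \<le> (\<integral>\<^sup>+x. ennreal (\<delta> powr (- \<alpha>) * B\<^sup>2) * indicator (cball 0 D) x \<partial>(lborel::'a measure))"
  proof (rule nn_integral_mono)
    fix x :: 'a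
    show "ennreal (norm x powr (- \<alpha>) * (norm (u x))\<^sup>2) \<le> ennreal (\<delta> powr (- \<alpha>) * B\<^sup>2) * indicator (cball 0 D) x"
      using uD[of x] u0(2)[of x] u0(1) B[of x] \<alpha>
      by (cases "D < norm x"; cases "norm x < \<delta>")
         (auto simp: indicator_def intro!: ennreal_leI mult_mono powr_mono2' power_mono)
  qed
  also have "\<dots> < \<infinity>"
    by (simp add: nn_integral_cmult_indicator ennreal_mult_less_top emeasure_lborel_cball_finite[unfolded infinity_ennreal_def])
  finally obtain N where N: "?N = ennreal N" "0 \<le> N"
    by (cases ?N) auto
  let ?E = "\<integral>\<^sup>+x. ennreal (norm x powr (- \<alpha>) * (norm (u x - u ((1/2) *\<^sub>R x)))\<^sup>2) \<partial>lborel"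
  have "?E \<le> ennreal ((1 - 1/2)\<^sup>2 * (1/2) powr (\<alpha> - real DIM('a) - 2) * D powr (2 - \<alpha>)) * (\<integral>\<^sup>+x. ennreal (v x) \<partial>lborel)"
    by (rule nn_integral_dilation_difference[OF u v vnn _ _ \<alpha> vD seg]) auto
  \<comment> \<open>At s = 1/2 the constant is 2^(-2) 2^(n+2-\<alpha>), which is the dilation ratio
    \<open>q\<close> again.\<close>
  also have "(1 - 1/2)\<^sup>2 * (1/2) powr (\<alpha> - real DIM('a) - 2) = q"
  proof -
    have "- (\<alpha> - real DIM('a) - 2) = real DIM('a) - \<alpha> + 2" by simp
    then show ?thesis
      unfolding half by (simp only: powr_add q_def) (simp add: power2_eq_square)
  qed
  also have "ennreal (q * D powr (2 - \<alpha>)) * (\<integral>\<^sup>+x. ennreal (v x) \<partial>lborel)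
     \<le> ennreal (q * D powr (2 - \<alpha>)) * ennreal G"
    by (intro mult_left_mono G) simp
  also have "\<dots> = ennreal (q * D powr (2 - \<alpha>) * G)"
    using q by (simp add: ennreal_mult'[symmetric])
  finally have E: "?E \<le> ennreal (q * D powr (2 - \<alpha>) * G)" .
  have e: "norm x powr - \<alpha> = 2 powr (- \<alpha>) * norm ((1/2) *\<^sub>R x) powr (- \<alpha>)" for x :: 'a
    by (simp add: powr_mult[symmetric])
  have "(\<integral>\<^sup>+x. ennreal (norm x powr (- \<alpha>) * (norm (u ((1/2) *\<^sub>R x)))\<^sup>2) \<partial>lborel)
    = (\<integral>\<^sup>+x. ennreal (2 powr (- \<alpha>) * norm ((1/2) *\<^sub>R x) powr (- \<alpha>) * (norm (u ((1/2) *\<^sub>R x)))\<^sup>2) \<partial>lborel)"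
    by (subst e) simp
  also have "\<dots> = ennreal ((1/2) powr (- real DIM('a))) *
      (\<integral>\<^sup>+x. ennreal (2 powr (- \<alpha>) * norm x powr (- \<alpha>) * (norm (u x))\<^sup>2) \<partial>lborel)"
    by (rule nn_integral_lborel_scaleR'[where g="\<lambda>x. ennreal (2 powr (- \<alpha>) * norm x powr (- \<alpha>) * (norm (u x))\<^sup>2)"]) auto
  also have "\<dots> = ennreal ((1/2) powr (- real DIM('a))) * (ennreal (2 powr (- \<alpha>)) * ?N)"
    by (subst nn_integral_cmult[symmetric]) (simp_all add: ennreal_mult'[symmetric] mult.assoc)
  also have "\<dots> = ennreal (q * N)"
  proof -
    have "2 powr real DIM('a) * 2 powr (- \<alpha>) = q"
      unfolding powr_add[symmetric] q_def by simp
    then show ?thesis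
      unfolding N half by (simp add: ennreal_mult'[symmetric] mult.assoc[symmetric])
  qed
  finally have "ennreal (q * N) = (\<integral>\<^sup>+x. ennreal (norm x powr (- \<alpha>) * (norm (u ((1/2) *\<^sub>R x)))\<^sup>2) \<partial>lborel)" by simp
  also have "\<dots> \<le> (\<integral>\<^sup>+x. 2 * ennreal (norm x powr (- \<alpha>) * (norm (u x))\<^sup>2)
       + 2 * ennreal (norm x powr (- \<alpha>) * (norm (u x - u ((1/2) *\<^sub>R x)))\<^sup>2) \<partial>lborel)"
  proof (rule nn_integral_mono)
    fix x :: 'a
    let ?a = "u x" and ?b = "u ((1/2) *\<^sub>R x)"
    have "norm ?b \<le> norm ?a + norm (?a - ?b)"
      using norm_triangle_ineq4[of ?a "?a - ?b"] by simp
    then have "(norm ?b)\<^sup>2 \<le> (norm ?a + norm (?a - ?b))\<^sup>2"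
      by (rule power_mono) simp
    also have "\<dots> \<le> 2 * (norm ?a)\<^sup>2 + 2 * (norm (?a - ?b))\<^sup>2"
      using sum_squares_bound[of "norm ?a" "norm (?a - ?b)"] by (simp add: power2_sum)
    finally have "norm x powr (- \<alpha>) * (norm ?b)\<^sup>2
       \<le> norm x powr (- \<alpha>) * (2 * (norm ?a)\<^sup>2 + 2 * (norm (?a - ?b))\<^sup>2)"
      by (rule mult_left_mono) simp
    also have "\<dots> = 2 * (norm x powr (- \<alpha>) * (norm ?a)\<^sup>2) + 2 * (norm x powr (- \<alpha>) * (norm (?a - ?b))\<^sup>2)"
      by (simp add: algebra_simps)
    finally have "ennreal (norm x powr (- \<alpha>) * (norm ?b)\<^sup>2)
       \<le> ennreal (2 * (norm x powr (- \<alpha>) * (norm ?a)\<^sup>2) + 2 * (norm x powr (- \<alpha>) * (norm (?a - ?b))\<^sup>2))"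
      by (rule ennreal_leI)
    then show "ennreal (norm x powr (- \<alpha>) * (norm ?b)\<^sup>2)
       \<le> 2 * ennreal (norm x powr (- \<alpha>) * (norm ?a)\<^sup>2) + 2 * ennreal (norm x powr (- \<alpha>) * (norm (?a - ?b))\<^sup>2)"
      by (simp add: ennreal_plus ennreal_mult')
  qed
  also have "\<dots> = 2 * ?N + 2 * ?E"
    by (simp add: nn_integral_add nn_integral_cmult)
  also have "\<dots> \<le> 2 * ennreal N + 2 * ennreal (q * D powr (2 - \<alpha>) * G)"
    unfolding N by (intro add_left_mono mult_left_mono E) auto
  also have "\<dots> = ennreal (2 * N + 2 * (q * D powr (2 - \<alpha>) * G))"
    using N(2) q G by (simp add: ennreal_plus ennreal_mult')
  finally have "q * N \<le> 2 * N + 2 * (q * D powr (2 - \<alpha>) * G)"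
    using N(2) q G by (subst (asm) ennreal_le_iff) auto
  then have "N \<le> 2 * (q * D powr (2 - \<alpha>) * G) / (q - 2)"
    using q by (simp add: field_simps)
  then show ?thesis
    unfolding N q_def[symmetric] by (rule ennreal_leI)
qed

section \<open>Absolute convergence of the kernel form\<close>

lemma nn_integral_Beta:
  assumes "0 < a" "0 < b"
  shows "(\<integral>\<^sup>+s. ennreal ((1 - s) powr (b - 1) * s powr (a - 1)) * indicator {0<..<1} s \<partial>lborel) = ennreal (Beta a b)"
proof -
  have "((\<lambda>t. (1 - t) powr (b - 1) * t powr (a - 1)) has_integral Beta a b) {0<..<1}"
    using has_integral_Beta_real[OF assms] by (simp add: has_integral_Icc_iff_Ioo mult.commute)
  from nn_integral_has_integral_lebesgue'[OF _ this] show ?thesis by simp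
qed

text \<open>This finiteness licenses Fubini for the full form and, later, dominated convergence when
  the cut-off is removed. \<open>N\<close> is the conclusion of the Hardy inequality;
  \<open>E\<close> has the shape delivered by
  \<open>nn_integral_dilation_difference\<close>.\<close>

lemma nn_integral_kernel_finite:
  fixes F :: "'a::euclidean_space \<Rightarrow> complex"
  assumes n: "2 \<le> DIM('a)" and [measurable]: "F \<in> borel_measurable borel"
    and \<alpha>: "0 < \<alpha>" "\<alpha> < 1"
    and N: "(\<integral>\<^sup>+x. ennreal (norm x powr (- \<alpha>) * (norm (F x))\<^sup>2) \<partial>lborel) < \<infinity>"
    and L: "0 \<le> L"
    and E: "\<And>s. 0 < s \<Longrightarrow> s < 1 \<Longrightarrow>
      (\<integral>\<^sup>+x. ennreal (norm x powr (- \<alpha>) * (norm (F x - F (s *\<^sub>R x)))\<^sup>2) \<partial>lborel)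
      \<le> ennreal ((1 - s)\<^sup>2 * s powr (\<alpha> - real DIM('a) - 2) * L)"
  shows "(\<integral>\<^sup>+x. \<integral>\<^sup>+s. ennreal (norm x powr (- \<alpha>) * (norm (F x) * norm (F x - F (s *\<^sub>R x))) *
      ((1 - s) powr (- \<alpha> - 1) * s ^ (DIM('a) - 1))) * indicator {0<..<1} s \<partial>lborel \<partial>lborel) < \<infinity>"
proof -
  let ?N = "\<integral>\<^sup>+x. ennreal (norm x powr (- \<alpha>) * (norm (F x))\<^sup>2) \<partial>lborel"
  (* The kernel is p q with p integrable; AM-GM puts q on the difference, and q^2 times the bound E
     on the squared difference stays bounded. *)
  define p where "p s = (1 - s) powr (- \<alpha>) * s powr (\<alpha>/2 - 1)" for s :: real
  define q where "q s = (1 - s) powr (- 1) * s powr (real DIM('a) - \<alpha>/2)" for s :: real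
  have [measurable]: "p \<in> borel_measurable borel" "q \<in> borel_measurable borel"
    by (auto simp: p_def[abs_def] q_def[abs_def])
  have pnn: "0 \<le> p s" for s by (simp add: p_def)
  have "(\<integral>\<^sup>+x. \<integral>\<^sup>+s. ennreal (norm x powr (- \<alpha>) * (norm (F x) * norm (F x - F (s *\<^sub>R x))) *
      ((1 - s) powr (- \<alpha> - 1) * s ^ (DIM('a) - 1))) * indicator {0<..<1} s \<partial>lborel \<partial>lborel)
    = (\<integral>\<^sup>+s. \<integral>\<^sup>+x. ennreal (norm x powr (- \<alpha>) * (norm (F x) * norm (F x - F (s *\<^sub>R x))) *
      ((1 - s) powr (- \<alpha> - 1) * s ^ (DIM('a) - 1))) * indicator {0<..<1} s \<partial>lborel \<partial>lborel)"
    by (rule lborel_pair.Fubini'[symmetric]) measurable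
  also have "\<dots> \<le> (\<integral>\<^sup>+s. (?N + ennreal L) * (ennreal (p s) * indicator {0<..<1} s) \<partial>lborel)"
  proof (rule nn_integral_mono)
    fix s :: real
    show "(\<integral>\<^sup>+x. ennreal (norm x powr (- \<alpha>) * (norm (F x) * norm (F x - F (s *\<^sub>R x))) *
      ((1 - s) powr (- \<alpha> - 1) * s ^ (DIM('a) - 1))) * indicator {0<..<1} s \<partial>lborel)
      \<le> (?N + ennreal L) * (ennreal (p s) * indicator {0<..<1} s)"
    proof (cases "s \<in> {0<..<1}")
      case True
      then have s: "0 < s" "s < 1" by auto
      have k: "(1 - s) powr (- \<alpha> - 1) * s ^ (DIM('a) - 1) = p s * q s"
      proof -
        have "s ^ (DIM('a) - 1) = s powr (\<alpha>/2 - 1 + (real DIM('a) - \<alpha>/2))"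
          using s n by (simp add: powr_realpow[symmetric] of_nat_diff)
        moreover have "(1 - s) powr (- \<alpha> - 1) = (1 - s) powr (- \<alpha>) * (1 - s) powr (- 1)"
          unfolding powr_add[symmetric] by simp
        ultimately show ?thesis by (simp only: p_def q_def powr_add mult_ac)
      qed
      have "(\<integral>\<^sup>+x. ennreal (norm x powr (- \<alpha>) * (norm (F x) * norm (F x - F (s *\<^sub>R x))) *
          ((1 - s) powr (- \<alpha> - 1) * s ^ (DIM('a) - 1))) \<partial>lborel)
        \<le> (\<integral>\<^sup>+x. ennreal (p s) * (ennreal (norm x powr (- \<alpha>) * (norm (F x))\<^sup>2) 
            + ennreal ((q s)\<^sup>2) * ennreal (norm x powr (- \<alpha>) * (norm (F x - F (s *\<^sub>R x)))\<^sup>2)) \<partial>lborel)"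
      proof (rule nn_integral_mono)
        fix x :: 'a
        let ?a = "norm (F x)" and ?b = "norm (F x - F (s *\<^sub>R x))"
        have "?a * (?b * q s) \<le> ?a\<^sup>2 + (?b * q s)\<^sup>2"
          using sum_squares_bound[of ?a "?b * q s"] zero_le_power2[of ?a] zero_le_power2[of "?b * q s"] by argo
        then have "norm x powr (- \<alpha>) * p s * (?a * (?b * q s)) \<le> norm x powr (- \<alpha>) * p s * (?a\<^sup>2 + (?b * q s)\<^sup>2)"
          by (rule mult_left_mono) (simp add: pnn)
        then have "norm x powr (- \<alpha>) * (?a * ?b) * (p s * q s) \<le> p s * (norm x powr (- \<alpha>) * ?a\<^sup>2 + (q s)\<^sup>2 * (norm x powr (- \<alpha>) * ?b\<^sup>2))"
          by (simp add: algebra_simps power_mult_distrib)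
        then show "ennreal (norm x powr (- \<alpha>) * (?a * ?b) * ((1 - s) powr (- \<alpha> - 1) * s ^ (DIM('a) - 1)))
          \<le> ennreal (p s) * (ennreal (norm x powr (- \<alpha>) * ?a\<^sup>2) + ennreal ((q s)\<^sup>2) * ennreal (norm x powr (- \<alpha>) * ?b\<^sup>2))"
          unfolding k by (simp add: ennreal_plus[symmetric] ennreal_mult'[symmetric] pnn ennreal_leI del: ennreal_plus)
      qed
      also have "\<dots> = ennreal (p s) * (?N + ennreal ((q s)\<^sup>2) * (\<integral>\<^sup>+x. ennreal (norm x powr (- \<alpha>) * (norm (F x - F (s *\<^sub>R x)))\<^sup>2) \<partial>lborel))"
        by (simp add: nn_integral_cmult nn_integral_add)
      also have "\<dots> \<le> ennreal (p s) * (?N + ennreal ((q s)\<^sup>2) * ennreal ((1 - s)\<^sup>2 * s powr (\<alpha> - real DIM('a) - 2) * L))"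
        by (intro mult_left_mono add_left_mono E s) auto
      also have "\<dots> \<le> ennreal (p s) * (?N + ennreal L)"
      proof -
        \<comment> \<open>The exponent \<alpha>/2 in \<open>p\<close> and \<open>q\<close> splits
          s^(n-1) so that \<open>p\<close> stays integrable at 0, while the square of
          \<open>q\<close> times the bound \<open>E\<close> leaves s^(n-2), which is at most 1
          because n \<ge> 2.\<close>
        have "(q s)\<^sup>2 * ((1 - s)\<^sup>2 * s powr (\<alpha> - real DIM('a) - 2)) = s powr (real DIM('a) - 2)"
        proof -
          have "((1 - s) powr (- 1))\<^sup>2 * (1 - s)\<^sup>2 = 1"
            using s by (simp add: powr_minus field_simps)
          moreover have "(s powr (real DIM('a) - \<alpha>/2))\<^sup>2 * s powr (\<alpha> - real DIM('a) - 2) = s powr (real DIM('a) - 2)"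
            unfolding power2_eq_square powr_add[symmetric] by (simp add: algebra_simps)
          ultimately show ?thesis
            unfolding q_def power_mult_distrib
            by (metis (no_types, opaque_lifting) mult.assoc mult.left_commute mult.right_neutral)
        qed
        also have "\<dots> \<le> 1"
          using s n powr_mono'[of 0 "real DIM('a) - 2" s] by simp
        finally have "(q s)\<^sup>2 * ((1 - s)\<^sup>2 * s powr (\<alpha> - real DIM('a) - 2)) * L \<le> 1 * L"
          by (rule mult_right_mono) (rule L)
        then have "ennreal ((q s)\<^sup>2) * ennreal ((1 - s)\<^sup>2 * s powr (\<alpha> - real DIM('a) - 2) * L) \<le> ennreal L"
          by (subst ennreal_mult'[symmetric]) (auto intro!: ennreal_leI simp: mult_ac)
        then show ?thesis by (intro mult_left_mono add_left_mono) auto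
      qed
      finally show ?thesis using True by (simp add: mult.commute)
    qed simp
  qed
  also have "\<dots> = (?N + ennreal L) * ennreal (Beta (\<alpha>/2) (1 - \<alpha>))"
    using nn_integral_Beta[of "\<alpha>/2" "1 - \<alpha>"] \<alpha> by (subst nn_integral_cmult) (auto simp: p_def)
  also have "\<dots> < \<infinity>"
    using N by (simp add: ennreal_mult_less_top less_top)
  finally show ?thesis .
qed

section \<open>Kernel integrals\<close>

text \<open>The antiderivative is (s/(1-s))^\<alpha>/\<alpha>. Later c is |y|/D, and the subtracted
  term is the source of the gain D^(-\<alpha>). Lowering c/(1-c) to h c, and not just to c, keeps
  the bound nonnegative also for c > h, where the range of integration is empty; the extra factor h
  tends to 1 in the end.\<close>

lemma nn_integral_dilated_kernel_le:
  assumes "0 < c" "c \<le> 1" "0 < h" "h < 1" "0 < (\<alpha>::real)"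
  shows "(\<integral>\<^sup>+s. ennreal ((1 - s) powr (- \<alpha> - 1) * s powr (\<alpha> - 1)) * indicator {c..h} s \<partial>lborel)
    \<le> ennreal (((h / (1 - h)) powr \<alpha> - (h * c) powr \<alpha>) / \<alpha>)"
proof (cases "c \<le> h")
  case True
  have "(\<integral>\<^sup>+s. ennreal ((1 - s) powr (- \<alpha> - 1) * s powr (\<alpha> - 1)) * indicator {c..h} s \<partial>lborel)
    = ennreal ((h / (1 - h)) powr \<alpha> / \<alpha> - (c / (1 - c)) powr \<alpha> / \<alpha>)"
  proof (rule nn_integral_FTC_Icc)
    fix s assume s: "s \<in> {c..h}"
    have s': "0 < s" "s < 1" using s assms by auto
    have d: "((\<lambda>s. s / (1 - s)) has_real_derivative 1 / (1 - s)\<^sup>2) (at s)"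
      using s' by (auto intro!: derivative_eq_intros simp: field_simps power2_eq_square)
    have "((\<lambda>s. (s / (1 - s)) powr \<alpha> / \<alpha>) has_real_derivative
       \<alpha> * (s / (1 - s)) powr (\<alpha> - 1) * (1 / (1 - s)\<^sup>2) / \<alpha>) (at s)"
      using s' by (intro DERIV_cdivide DERIV_chain2[OF has_real_derivative_powr d]) auto
    also have "\<alpha> * (s / (1 - s)) powr (\<alpha> - 1) * (1 / (1 - s)\<^sup>2) / \<alpha> = (s / (1 - s)) powr (\<alpha> - 1) * (1 / (1 - s)\<^sup>2)"
      using assms by simp
    also have "(s / (1 - s)) powr (\<alpha> - 1) * (1 / (1 - s)\<^sup>2) = (1 - s) powr (- \<alpha> - 1) * s powr (\<alpha> - 1)"
    proof -
      have "(1 - s)\<^sup>2 = (1 - s) powr 2" using s' by simp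
      moreover have "(1 - s) powr (- \<alpha> - 1) = 1 / ((1 - s) powr (\<alpha> - 1) * (1 - s) powr 2)"
      proof -
        have "- \<alpha> - 1 = - ((\<alpha> - 1) + 2)" by simp
        then show ?thesis by (simp only: powr_minus_divide powr_add)
      qed
      ultimately show ?thesis using s' by (simp add: powr_divide)
    qed
    finally show "((\<lambda>s. (s / (1 - s)) powr \<alpha> / \<alpha>) has_real_derivative (1 - s) powr (- \<alpha> - 1) * s powr (\<alpha> - 1)) (at s)" .
  qed (use True assms in auto)
  also have "\<dots> \<le> ennreal (((h / (1 - h)) powr \<alpha> - (h * c) powr \<alpha>) / \<alpha>)"
  proof -
    have "h * c \<le> c / (1 - c)"
    proof -
      have "h * c \<le> c" using assms by (simp add: mult_left_le_one_le)
      also have "c \<le> c / (1 - c)" using assms True by (simp add: field_simps)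
      finally show ?thesis .
    qed
    then have "(h * c) powr \<alpha> \<le> (c / (1 - c)) powr \<alpha>"
      using assms by (intro powr_mono2) auto
    then show ?thesis using assms
      by (intro ennreal_leI) (simp add: diff_divide_distrib[symmetric] divide_right_mono)
  qed
  finally show ?thesis .
qed simp

text \<open>With \<gamma> = \<beta> - \<alpha> this is the dilated kernel times the Hoelder factor
  ((1-s)/s)^\<beta>, and it has the antiderivative -((1-s)/s)^\<gamma>/\<gamma>. Since \<gamma> > 0
  the bound is uniform in h, so this error needs no cancellation; at c = |y|/D it becomes the term
  D^(\<beta>-\<alpha>)/(\<beta>-\<alpha>).\<close>

lemma nn_integral_Hoelder_kernel_le:
  assumes c: "0 < c" "c \<le> 1" "h < 1" and \<gamma>: "0 < (\<gamma>::real)"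
  shows "(\<integral>\<^sup>+s. ennreal ((1 - s) powr (\<gamma> - 1) * s powr (- \<gamma> - 1)) * indicator {c..h} s \<partial>lborel)
    \<le> ennreal (c powr (- \<gamma>) / \<gamma>)"
proof (cases "c \<le> h")
  case True
  have "(\<integral>\<^sup>+s. ennreal ((1 - s) powr (\<gamma> - 1) * s powr (- \<gamma> - 1)) * indicator {c..h} s \<partial>lborel)
    = ennreal (- (((1 - h) / h) powr \<gamma>) / \<gamma> - (- (((1 - c) / c) powr \<gamma>) / \<gamma>))"
  proof (rule nn_integral_FTC_Icc)
    fix s assume s: "s \<in> {c..h}"
    have s': "0 < s" "s < 1" using s assms by auto
    have d: "((\<lambda>s. (1 - s) / s) has_real_derivative - (1 / s\<^sup>2)) (at s)"
      using s' by (auto intro!: derivative_eq_intros simp: field_simps power2_eq_square)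
    have "((\<lambda>s. - (((1 - s) / s) powr \<gamma>) / \<gamma>) has_real_derivative
       - (\<gamma> * ((1 - s) / s) powr (\<gamma> - 1) * - (1 / s\<^sup>2)) / \<gamma>) (at s)"
      using s' by (intro DERIV_cdivide DERIV_minus DERIV_chain2[OF has_real_derivative_powr d]) auto
    also have "- (\<gamma> * ((1 - s) / s) powr (\<gamma> - 1) * - (1 / s\<^sup>2)) / \<gamma> = ((1 - s) / s) powr (\<gamma> - 1) * (1 / s\<^sup>2)"
      using assms by simp
    also have "((1 - s) / s) powr (\<gamma> - 1) * (1 / s\<^sup>2) = (1 - s) powr (\<gamma> - 1) * s powr (- \<gamma> - 1)"
    proof -
      have "s\<^sup>2 = s powr 2" using s' by simp
      moreover have "s powr (- \<gamma> - 1) = 1 / (s powr (\<gamma> - 1) * s powr 2)"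
      proof -
        have "- \<gamma> - 1 = - ((\<gamma> - 1) + 2)" by simp
        then show ?thesis by (simp only: powr_minus_divide powr_add)
      qed
      ultimately show ?thesis using s' by (simp add: powr_divide)
    qed
    finally show "((\<lambda>s. - (((1 - s) / s) powr \<gamma>) / \<gamma>) has_real_derivative (1 - s) powr (\<gamma> - 1) * s powr (- \<gamma> - 1)) (at s)" .
  qed (use True assms in auto)
  also have "\<dots> \<le> ennreal (c powr (- \<gamma>) / \<gamma>)"
  proof (rule ennreal_leI)
    have "((1 - c) / c) powr \<gamma> \<le> (1 / c) powr \<gamma>"
      using assms by (intro powr_mono2) (auto simp: divide_right_mono)
    also have "\<dots> = c powr (- \<gamma>)"
      using c by (simp add: powr_divide powr_minus_divide)
    finally have "((1 - c) / c) powr \<gamma> / \<gamma> \<le> c powr (- \<gamma>) / \<gamma>"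
      using \<gamma> by (intro divide_right_mono) auto
    moreover have "0 \<le> ((1 - h) / h) powr \<gamma> / \<gamma>" using \<gamma> by simp
    ultimately show "- (((1 - h) / h) powr \<gamma>) / \<gamma> - (- (((1 - c) / c) powr \<gamma>) / \<gamma>) \<le> c powr (- \<gamma>) / \<gamma>"
      by simp
  qed
  finally show ?thesis .
qed simp

text \<open>Integration by parts: the derivative of s^(n-1) (1-s)^(-\<alpha>)/\<alpha> is the kernel
  plus (n-1)/\<alpha> (1-s)^(-\<alpha>) s^(n-2). The latter is integrable up to 1, and its Beta
  integral is the added constant, which becomes \<open>kipriyanov_const\<close> after multiplication
  by \<alpha>/Gamma(1-\<alpha>).\<close>

lemma nn_integral_kernel_ge:
  assumes h: "0 < h" "h < 1" and n: "2 \<le> n" and \<alpha>: "0 < \<alpha>" "\<alpha> < (1::real)"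
  shows "ennreal (h ^ (n - 1) * (1 - h) powr (- \<alpha>) / \<alpha>)
    \<le> (\<integral>\<^sup>+s. ennreal ((1 - s) powr (- \<alpha> - 1) * s ^ (n - 1)) * indicator {0..h} s \<partial>lborel)
      + ennreal (fact (n - 1) * Gamma (1 - \<alpha>) / (\<alpha> * Gamma (real n - \<alpha>)))"
proof -
  define c where "c = real (n - 1) / \<alpha>"
  have c: "0 \<le> c" using \<alpha> by (simp add: c_def)
  have "ennreal (h ^ (n - 1) * (1 - h) powr (- \<alpha>) / \<alpha> - 0 ^ (n - 1) * (1 - 0) powr (- \<alpha>) / \<alpha>)
    = (\<integral>\<^sup>+s. ennreal ((1 - s) powr (- \<alpha> - 1) * s ^ (n - 1) + c * ((1 - s) powr (- \<alpha>) * s ^ (n - 2))) * indicator {0..h} s \<partial>lborel)"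
  proof (rule nn_integral_FTC_Icc[symmetric])
    fix s assume s: "s \<in> {0..h}"
    have s': "s < 1" using s h by auto
    have nn: "n - Suc (Suc 0) = n - 2" by (simp add: numeral_2_eq_2)
    show "((\<lambda>s. s ^ (n - 1) * (1 - s) powr (- \<alpha>) / \<alpha>) has_real_derivative
        (1 - s) powr (- \<alpha> - 1) * s ^ (n - 1) + c * ((1 - s) powr (- \<alpha>) * s ^ (n - 2))) (at s)"
      using s' \<alpha> by (auto intro!: derivative_eq_intros simp: c_def nn field_simps)
  qed (use h c in auto)
  moreover have z: "0 ^ (n - 1) = (0::real)" using n by simp
  ultimately have "ennreal (h ^ (n - 1) * (1 - h) powr (- \<alpha>) / \<alpha>)
    = (\<integral>\<^sup>+s. ennreal ((1 - s) powr (- \<alpha> - 1) * s ^ (n - 1) + c * ((1 - s) powr (- \<alpha>) * s ^ (n - 2))) * indicator {0..h} s \<partial>lborel)"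
    unfolding z by simp
  also have "\<dots> \<le> (\<integral>\<^sup>+s. ennreal ((1 - s) powr (- \<alpha> - 1) * s ^ (n - 1)) * indicator {0..h} s
       + ennreal c * (ennreal ((1 - s) powr ((1 - \<alpha>) - 1) * s powr ((real n - 1) - 1)) * indicator {0<..<1} s) \<partial>lborel)"
  \<comment> \<open>The point s = 0 is left out because for n = 2 it has \<open>0 powr 0 = 0\<close>
    but \<open>0 ^ 0 = 1\<close>.\<close>
  proof (rule nn_integral_mono_AE, rule AE_mp[OF AE_lborel_singleton[of 0]], rule AE_I2, rule impI)
    fix s :: real
    assume "s \<noteq> 0"
    then have "s powr (real n - 1 - 1) = s ^ (n - 2)" if "0 \<le> s"
      using that n by (simp add: powr_realpow[symmetric] of_nat_diff)
    then show "ennreal ((1 - s) powr (- \<alpha> - 1) * s ^ (n - 1) + c * ((1 - s) powr (- \<alpha>) * s ^ (n - 2))) * indicator {0..h} s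
      \<le> ennreal ((1 - s) powr (- \<alpha> - 1) * s ^ (n - 1)) * indicator {0..h} s
       + ennreal c * (ennreal ((1 - s) powr ((1 - \<alpha>) - 1) * s powr ((real n - 1) - 1)) * indicator {0<..<1} s)"
      using c h \<open>s \<noteq> 0\<close> by (auto simp: indicator_def ennreal_plus ennreal_mult')
  qed
  also have "\<dots> = (\<integral>\<^sup>+s. ennreal ((1 - s) powr (- \<alpha> - 1) * s ^ (n - 1)) * indicator {0..h} s \<partial>lborel)
     + ennreal c * ennreal (Beta (real n - 1) (1 - \<alpha>))"
    using nn_integral_Beta[of "real n - 1" "1 - \<alpha>"] n \<alpha> by (simp add: nn_integral_add nn_integral_cmult)
  also have "ennreal c * ennreal (Beta (real n - 1) (1 - \<alpha>)) = ennreal (fact (n - 1) * Gamma (1 - \<alpha>) / (\<alpha> * Gamma (real n - \<alpha>)))"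
  proof -
    obtain m where m: "n = Suc m" "0 < m" using n by (cases n) auto
    have "real m \<notin> \<int>\<^sub>\<le>\<^sub>0"
      using m(2) nonpos_Ints_nonpos[of "real m"] by auto
    then have "real m * Gamma (real m) = fact m"
      using Gamma_plus1[of "real m"] Gamma_fact[of m, where 'a = real] m(2)
      by (simp add: add.commute)
    then have "real (n - 1) * Gamma (real n - 1) = fact (n - 1)"
      by (simp add: m)
    then have "c * Beta (real n - 1) (1 - \<alpha>) = fact (n - 1) * Gamma (1 - \<alpha>) / (\<alpha> * Gamma (real n - \<alpha>))"
      by (simp add: c_def Beta_def algebra_simps)
    then show ?thesis using c by (simp add: ennreal_mult'[symmetric])
  qed
  finally show ?thesis .
qed

section \<open>Lower bound for the kernel form\<close>

text \<open>The substitution y = s x moves the dilation from \<open>F\<close> onto the weight and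
  leaves s^(-n) s^\<alpha> s^(n-1) = s^(\<alpha>-1). Now y/s has to lie in \<open>S\<close>, which
  forces s \<ge> |y|/D, and \<open>hyp\<close> replaces \<rho>(y/s) by \<rho>(y) plus an error. The
  second claim is there because \<open>ennreal\<close> sends negative reals to 0, so that the first
  alone would not bound a real integral.\<close>

lemma nn_integral_dilated_le:
  assumes n: "2 \<le> DIM('a)" and \<alpha>: "0 < \<alpha>" "\<alpha> < (1::real)" and \<beta>: "\<alpha> < \<beta>" and M: "0 \<le> M"
    and F[measurable]: "F \<in> borel_measurable borel" and \<rho>[measurable]: "\<rho> \<in> borel_measurable borel"
    and D: "0 < D"
    and SD: "\<And>x. x \<in> S \<Longrightarrow> norm x \<le> D" and S0: "0 \<notin> S"
    and FS: "\<And>x::'a::euclidean_space. x \<notin> S \<Longrightarrow> F x = (0::complex)"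
    and \<rho>S: "\<And>x. x \<notin> S \<Longrightarrow> \<rho> x = 0"
    and \<rho>: "\<And>x. 0 \<le> \<rho> x" "\<And>x. \<rho> x \<le> R"
    and hyp: "\<And>y s. y \<in> S \<Longrightarrow> 0 < s \<Longrightarrow> s < 1 \<Longrightarrow> y /\<^sub>R s \<in> S \<Longrightarrow>
        \<rho> (y /\<^sub>R s) \<le> \<rho> y + M * (norm y * (1 - s) / s) powr \<beta>"
    and int: "integrable lborel (\<lambda>x. norm x powr (- \<alpha>) * (norm (F x))\<^sup>2)"
    and h: "0 < h" "h < 1"
  defines "k \<equiv> \<lambda>s::real. (1 - s) powr (- \<alpha> - 1) * s ^ (DIM('a) - 1)"
  shows "(\<integral>\<^sup>+s. \<integral>\<^sup>+x. ennreal ((norm (F (s *\<^sub>R x)))\<^sup>2 * (norm x powr (- \<alpha>) * \<rho> x) * k s) * indicator {0<..h} s \<partial>lborel \<partial>lborel)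
    \<le> ennreal ((h / (1 - h)) powr \<alpha> / \<alpha> * (\<integral>x. norm x powr (- \<alpha>) * (norm (F x))\<^sup>2 * \<rho> x \<partial>lborel)
        - (h / D) powr \<alpha> / \<alpha> * (\<integral>x. (norm (F x))\<^sup>2 * \<rho> x \<partial>lborel)
        + M * D powr (\<beta> - \<alpha>) / (\<beta> - \<alpha>) * (\<integral>x. (norm (F x))\<^sup>2 \<partial>lborel))"
    and "0 \<le> (h / (1 - h)) powr \<alpha> / \<alpha> * (\<integral>x. norm x powr (- \<alpha>) * (norm (F x))\<^sup>2 * \<rho> x \<partial>lborel)
        - (h / D) powr \<alpha> / \<alpha> * (\<integral>x. (norm (F x))\<^sup>2 * \<rho> x \<partial>lborel)
        + M * D powr (\<beta> - \<alpha>) / (\<beta> - \<alpha>) * (\<integral>x. (norm (F x))\<^sup>2 \<partial>lborel)"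
proof -
  define b where "b = (h / (1 - h)) powr \<alpha>"
  have [measurable]: "k \<in> borel_measurable borel" by (simp add: k_def)
  have int0: "integrable lborel (\<lambda>x. (norm (F x))\<^sup>2)"
  proof (rule Bochner_Integration.integrable_bound[OF integrable_mult_right[OF int, of "D powr \<alpha>"]])
    show "AE x in lborel. norm ((norm (F x))\<^sup>2) \<le> norm (D powr \<alpha> * (norm x powr (- \<alpha>) * (norm (F x))\<^sup>2))"
    proof (rule AE_I2)
      fix x :: 'a
      show "norm ((norm (F x))\<^sup>2) \<le> norm (D powr \<alpha> * (norm x powr (- \<alpha>) * (norm (F x))\<^sup>2))"
      proof (cases "x \<in> S")
        case True
        then have "0 < norm x" "norm x \<le> D" using SD S0 by auto
        then have "D powr (-\<alpha>) \<le> norm x powr (- \<alpha>)" using \<alpha> by (intro powr_mono2') auto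
        then have "1 \<le> D powr \<alpha> * norm x powr (- \<alpha>)"
          using D by (simp add: powr_minus field_simps)
        then have "1 * (norm (F x))\<^sup>2 \<le> D powr \<alpha> * norm x powr (- \<alpha>) * (norm (F x))\<^sup>2"
          by (rule mult_right_mono) simp
        then show ?thesis by (simp add: mult.assoc)
      qed (simp add: FS)
    qed
  qed simp
  have R: "\<rho> x \<le> \<bar>R\<bar>" for x using \<rho>(2)[of x] by linarith
  have int1: "integrable lborel (\<lambda>x. norm x powr (- \<alpha>) * (norm (F x))\<^sup>2 * \<rho> x)"
    by (rule Bochner_Integration.integrable_bound[OF integrable_mult_right[OF int, of R]])
       (use \<rho> in \<open>auto simp: abs_mult mult.commute[of _ "\<rho> _"] intro!: AE_I2 mult_right_mono R\<close>)
  have int2: "integrable lborel (\<lambda>x. (norm (F x))\<^sup>2 * \<rho> x)"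
    by (rule Bochner_Integration.integrable_bound[OF integrable_mult_right[OF int0, of R]])
       (use \<rho> in \<open>auto simp: abs_mult mult.commute[of _ "\<rho> _"] intro!: AE_I2 mult_right_mono R\<close>)
  \<comment> \<open>The integrand of the claimed bound. In \<open>Z_eq\<close> the powers of |y|
    cancel: |y|^(-\<alpha>) (h |y|/D)^\<alpha> = (h/D)^\<alpha>, and |y|^(\<beta>-\<alpha>)
    (|y|/D)^(-(\<beta>-\<alpha>)) = D^(\<beta>-\<alpha>).\<close>
  define Z where "Z y = b / \<alpha> * (norm y powr (- \<alpha>) * (norm (F y))\<^sup>2 * \<rho> y)
        - (h / D) powr \<alpha> / \<alpha> * ((norm (F y))\<^sup>2 * \<rho> y)
        + M * D powr (\<beta> - \<alpha>) / (\<beta> - \<alpha>) * (norm (F y))\<^sup>2" for y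
  have b_ge: "(h * (norm y / D)) powr \<alpha> \<le> b" if "y \<in> S" for y
  proof -
    define c where "c = norm y / D"
    have c: "0 \<le> c" "c \<le> 1" using SD[OF that] D by (auto simp: c_def)
    have "h * c \<le> h / (1 - h)"
    proof -
      have "h * c \<le> h * 1" using h c by (intro mult_left_mono) auto
      also have "h * 1 \<le> h / (1 - h)" using h by (simp add: field_simps)
      finally show ?thesis .
    qed
    then have "(h * c) powr \<alpha> \<le> b"
      unfolding b_def using h c \<alpha> by (intro powr_mono2) auto
    then show ?thesis by (simp add: c_def)
  qed
  have Z_eq: "Z y = norm y powr (- \<alpha>) * (norm (F y))\<^sup>2 * \<rho> y * ((b - (h * (norm y / D)) powr \<alpha>) / \<alpha>)
     + norm y powr (- \<alpha>) * (norm (F y))\<^sup>2 * (M * norm y powr \<beta>) * ((norm y / D) powr (- (\<beta> - \<alpha>)) / (\<beta> - \<alpha>))"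
    if "y \<in> S" for y
  proof -
    define r where "r = norm y"
    define \<gamma> where "\<gamma> = \<beta> - \<alpha>"
    define c where "c = r / D"
    have r: "0 < r" "r \<le> D" using that SD S0 by (auto simp: r_def)
    have \<gamma>: "0 < \<gamma>" using \<beta> by (simp add: \<gamma>_def)
    let ?A = "r powr (- \<alpha>) * (norm (F y))\<^sup>2"
    have 1: "r powr (- \<alpha>) * (h * c) powr \<alpha> = (h / D) powr \<alpha>"
      using r h D by (simp add: c_def powr_mult powr_divide powr_minus field_simps)
    have 2: "r powr (- \<alpha>) * r powr \<beta> * c powr (- \<gamma>) = D powr \<gamma>"
    proof -
      have p1: "c powr (- \<gamma>) = r powr (- \<gamma>) * D powr \<gamma>"
        using r D by (simp add: c_def powr_divide powr_minus_divide)
      have p2: "r powr (- \<alpha>) * r powr \<beta> * r powr (- \<gamma>) = 1"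
        unfolding powr_add[symmetric] using r by (simp add: \<gamma>_def)
      have "r powr (- \<alpha>) * r powr \<beta> * c powr (- \<gamma>) = (r powr (- \<alpha>) * r powr \<beta> * r powr (- \<gamma>)) * D powr \<gamma>"
        unfolding p1 by (simp only: mult_ac)
      then show ?thesis unfolding p2 by simp
    qed
    have "?A * \<rho> y * ((b - (h * c) powr \<alpha>) / \<alpha>) + ?A * (M * r powr \<beta>) * (c powr (- \<gamma>) / \<gamma>)
      = b / \<alpha> * (?A * \<rho> y) - (r powr (- \<alpha>) * (h * c) powr \<alpha>) / \<alpha> * ((norm (F y))\<^sup>2 * \<rho> y)
        + M * (r powr (- \<alpha>) * r powr \<beta> * c powr (- \<gamma>)) / \<gamma> * (norm (F y))\<^sup>2"
      using \<alpha> \<gamma> by (simp add: field_simps)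
    then show ?thesis unfolding 1 2 Z_def by (simp add: r_def \<gamma>_def c_def)
  qed
  have Z_nonneg: "0 \<le> Z y" for y
  proof (cases "y \<in> S")
    case True
    show ?thesis
      unfolding Z_eq[OF True] using b_ge[OF True] \<rho>(1) M \<alpha> \<beta>
      by (intro add_nonneg_nonneg mult_nonneg_nonneg divide_nonneg_nonneg) auto
  qed (simp add: Z_def FS)
  let ?k = "\<lambda>s. ennreal ((1 - s) powr (- \<alpha> - 1) * s powr (\<alpha> - 1)) * indicator {0<..h} s"
  have "(\<integral>\<^sup>+s. \<integral>\<^sup>+x. ennreal ((norm (F (s *\<^sub>R x)))\<^sup>2 * (norm x powr (- \<alpha>) * \<rho> x) * k s) * indicator {0<..h} s \<partial>lborel \<partial>lborel)
    = (\<integral>\<^sup>+s. \<integral>\<^sup>+y. ennreal (norm y powr (- \<alpha>) * (norm (F y))\<^sup>2 * \<rho> (y /\<^sub>R s)) * ?k s \<partial>lborel \<partial>lborel)"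
  proof (rule nn_integral_cong)
    fix s :: real
    show "(\<integral>\<^sup>+x. ennreal ((norm (F (s *\<^sub>R x)))\<^sup>2 * (norm x powr (- \<alpha>) * \<rho> x) * k s) * indicator {0<..h} s \<partial>lborel)
      = (\<integral>\<^sup>+y. ennreal (norm y powr (- \<alpha>) * (norm (F y))\<^sup>2 * \<rho> (y /\<^sub>R s)) * ?k s \<partial>lborel)"
    proof (cases "s \<in> {0<..h}")
      case True
      then have s: "0 < s" "s < 1" using h by auto
      let ?g = "\<lambda>y. ennreal ((norm (F y))\<^sup>2 * (norm (y /\<^sub>R s) powr (- \<alpha>) * \<rho> (y /\<^sub>R s)) * k s)"
      have "(\<integral>\<^sup>+x. ennreal ((norm (F (s *\<^sub>R x)))\<^sup>2 * (norm x powr (- \<alpha>) * \<rho> x) * k s) \<partial>lborel)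
        = (\<integral>\<^sup>+x. ?g (s *\<^sub>R x) \<partial>lborel)"
        using s by simp
      also have "\<dots> = ennreal (s powr (- real DIM('a))) * (\<integral>\<^sup>+y. ?g y \<partial>lborel)"
        by (rule nn_integral_lborel_scaleR'[OF _ s(1)]) measurable
      also have "\<dots> = (\<integral>\<^sup>+y. ennreal (s powr (- real DIM('a))) * ?g y \<partial>lborel)"
        by (rule nn_integral_cmult[symmetric]) measurable
      also have "\<dots> = (\<integral>\<^sup>+y. ennreal (norm y powr (- \<alpha>) * (norm (F y))\<^sup>2 * \<rho> (y /\<^sub>R s)) * ?k s \<partial>lborel)"
      proof (rule nn_integral_cong)
        fix y :: 'a
        have e1: "s powr (- real DIM('a)) * (s powr \<alpha> * s ^ (DIM('a) - 1)) = s powr (\<alpha> - 1)"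
          using s n by (simp add: powr_realpow[symmetric] powr_add[symmetric] of_nat_diff)
        have e2: "norm (y /\<^sub>R s) powr (- \<alpha>) = norm y powr (- \<alpha>) * s powr \<alpha>"
          using s by (simp add: powr_mult powr_minus inverse_powr)
        have "s powr (- real DIM('a)) * ((norm (F y))\<^sup>2 * (norm (y /\<^sub>R s) powr (- \<alpha>) * \<rho> (y /\<^sub>R s)) * k s)
          = norm y powr (- \<alpha>) * (norm (F y))\<^sup>2 * \<rho> (y /\<^sub>R s) * ((1 - s) powr (- \<alpha> - 1) * (s powr (- real DIM('a)) * (s powr \<alpha> * s ^ (DIM('a) - 1))))"
          unfolding k_def e2 by (simp only: mult_ac)
        note e3 = this[unfolded e1]
        have "ennreal (s powr (- real DIM('a))) * ?g y
          = ennreal (s powr (- real DIM('a)) * ((norm (F y))\<^sup>2 * (norm (y /\<^sub>R s) powr (- \<alpha>) * \<rho> (y /\<^sub>R s)) * k s))"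
          by (rule ennreal_mult'[symmetric]) simp
        also have "\<dots> = ennreal (norm y powr (- \<alpha>) * (norm (F y))\<^sup>2 * \<rho> (y /\<^sub>R s)) * ennreal ((1 - s) powr (- \<alpha> - 1) * s powr (\<alpha> - 1))"
          unfolding e3 using \<rho>(1) by (intro ennreal_mult'') simp
        finally show "ennreal (s powr (- real DIM('a))) * ?g y = ennreal (norm y powr (- \<alpha>) * (norm (F y))\<^sup>2 * \<rho> (y /\<^sub>R s)) * ?k s"
          using True by simp
      qed
      finally show ?thesis using True by simp
    qed simp
  qed
  also have "\<dots> = (\<integral>\<^sup>+y. \<integral>\<^sup>+s. ennreal (norm y powr (- \<alpha>) * (norm (F y))\<^sup>2 * \<rho> (y /\<^sub>R s)) * ?k s \<partial>lborel \<partial>lborel)"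
    by (rule lborel_pair.Fubini') measurable
  also have "\<dots> \<le> (\<integral>\<^sup>+y. ennreal (Z y) \<partial>lborel)"
  proof (rule nn_integral_mono)
    fix y :: 'a
    show "(\<integral>\<^sup>+s. ennreal (norm y powr (- \<alpha>) * (norm (F y))\<^sup>2 * \<rho> (y /\<^sub>R s)) * ?k s \<partial>lborel) \<le> ennreal (Z y)"
    proof (cases "y \<in> S")
      case True
      define r where "r = norm y"
      define \<gamma> where "\<gamma> = \<beta> - \<alpha>"
      have r: "0 < r" "r \<le> D" using True SD S0 by (auto simp: r_def)
      have \<gamma>: "0 < \<gamma>" using \<beta> by (simp add: \<gamma>_def)
      define c where "c = r / D"
      have c: "0 < c" "c \<le> 1" using r D by (auto simp: c_def)
      let ?A = "r powr (- \<alpha>) * (norm (F y))\<^sup>2"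
      let ?k1 = "\<lambda>s. ennreal ((1 - s) powr (- \<alpha> - 1) * s powr (\<alpha> - 1)) * indicator {c..h} s"
      let ?k2 = "\<lambda>s. ennreal ((1 - s) powr (\<gamma> - 1) * s powr (- \<gamma> - 1)) * indicator {c..h} s"
      have "(\<integral>\<^sup>+s. ennreal (norm y powr (- \<alpha>) * (norm (F y))\<^sup>2 * \<rho> (y /\<^sub>R s)) * ?k s \<partial>lborel)
        \<le> (\<integral>\<^sup>+s. ennreal (?A * \<rho> y) * ?k1 s + ennreal (?A * (M * r powr \<beta>)) * ?k2 s \<partial>lborel)"
      proof (rule nn_integral_mono)
        fix s :: real
        show "ennreal (norm y powr (- \<alpha>) * (norm (F y))\<^sup>2 * \<rho> (y /\<^sub>R s)) * ?k s
          \<le> ennreal (?A * \<rho> y) * ?k1 s + ennreal (?A * (M * r powr \<beta>)) * ?k2 s"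
        \<comment> \<open>\<rho> vanishes off \<open>S\<close>, so only those s with y/s in
          \<open>S\<close> count, and they satisfy c \<le> s. This truncation of the integral at
          \<open>c\<close> is where the gain originates.\<close>
        proof (cases "s \<in> {0<..h} \<and> y /\<^sub>R s \<in> S")
          case sS: True
          then have s: "0 < s" "s < 1" "s \<le> h" using h by auto
          have "norm (y /\<^sub>R s) \<le> D" using sS SD by blast
          then have "c \<le> s" using s D by (simp add: c_def r_def field_simps)
          have p1: "(r * (1 - s) / s) powr \<beta> = r powr \<beta> * ((1 - s) powr \<beta> * s powr (- \<beta>))"
            using s r by (simp add: powr_mult powr_divide powr_minus_divide)
          have p2: "(1 - s) powr \<beta> * (1 - s) powr (- \<alpha> - 1) = (1 - s) powr (\<gamma> - 1)"
            unfolding powr_add[symmetric] by (simp add: \<gamma>_def algebra_simps)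
          have p3: "s powr (- \<beta>) * s powr (\<alpha> - 1) = s powr (- \<gamma> - 1)"
            unfolding powr_add[symmetric] by (simp add: \<gamma>_def algebra_simps)
          have "(r * (1 - s) / s) powr \<beta> * ((1 - s) powr (- \<alpha> - 1) * s powr (\<alpha> - 1))
             = r powr \<beta> * (((1 - s) powr \<beta> * (1 - s) powr (- \<alpha> - 1)) * (s powr (- \<beta>) * s powr (\<alpha> - 1)))"
            unfolding p1 by (simp only: mult_ac)
          note e = this[unfolded p2 p3]
          let ?q = "(1 - s) powr (- \<alpha> - 1) * s powr (\<alpha> - 1)"
          have "?A * ?q * \<rho> (y /\<^sub>R s) \<le> ?A * ?q * (\<rho> y + M * (r * (1 - s) / s) powr \<beta>)"
            using hyp[OF True s(1,2)] sS by (intro mult_left_mono) (auto simp: r_def)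
          also have "\<dots> = ?A * \<rho> y * ?q + ?A * M * ((r * (1 - s) / s) powr \<beta> * ?q)"
            by (simp only: algebra_simps)
          also have "\<dots> = ?A * \<rho> y * ?q + ?A * (M * r powr \<beta>) * ((1 - s) powr (\<gamma> - 1) * s powr (- \<gamma> - 1))"
            unfolding e by (simp only: mult_ac)
          finally have le: "?A * \<rho> (y /\<^sub>R s) * ?q \<le> \<dots>" by (simp only: mult_ac)
          show ?thesis
            using \<open>c \<le> s\<close> s \<rho>(1) M
            by (simp add: ennreal_mult'[symmetric] ennreal_plus[symmetric] r_def[symmetric] del: ennreal_plus)
               (rule le)
        next
          case False
          then show ?thesis using \<rho>S[of "y /\<^sub>R s"] by (auto simp: indicator_def)
        qed
      qed
      also have "\<dots> = ennreal (?A * \<rho> y) * (\<integral>\<^sup>+s. ?k1 s \<partial>lborel) + ennreal (?A * (M * r powr \<beta>)) * (\<integral>\<^sup>+s. ?k2 s \<partial>lborel)"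
        by (simp add: nn_integral_add nn_integral_cmult)
      also have "\<dots> \<le> ennreal (?A * \<rho> y) * ennreal ((b - (h * c) powr \<alpha>) / \<alpha>) + ennreal (?A * (M * r powr \<beta>)) * ennreal (c powr (- \<gamma>) / \<gamma>)"
        unfolding b_def
        by (intro add_mono mult_left_mono nn_integral_dilated_kernel_le nn_integral_Hoelder_kernel_le c h \<alpha> \<gamma>) auto
      also have "\<dots> = ennreal (?A * \<rho> y * ((b - (h * c) powr \<alpha>) / \<alpha>) + ?A * (M * r powr \<beta>) * (c powr (- \<gamma>) / \<gamma>))"
      proof -
        have "(h * c) powr \<alpha> \<le> b"
          using b_ge[OF True] by (simp add: r_def c_def)
        then show ?thesis
          using \<rho>(1) M \<alpha> \<gamma> by (simp add: ennreal_mult'[symmetric] ennreal_plus[symmetric] del: ennreal_plus)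
      qed
      also have "?A * \<rho> y * ((b - (h * c) powr \<alpha>) / \<alpha>) + ?A * (M * r powr \<beta>) * (c powr (- \<gamma>) / \<gamma>) = Z y"
        using Z_eq[OF True] by (simp add: r_def c_def \<gamma>_def)
      finally show ?thesis .
    qed (simp add: FS)
  qed
  also have "\<dots> = ennreal (\<integral>y. Z y \<partial>lborel)"
    using Z_nonneg by (intro nn_integral_eq_integral) (auto simp: Z_def[abs_def] int0 int1 int2)
  finally have le: "(\<integral>\<^sup>+s. \<integral>\<^sup>+x. ennreal ((norm (F (s *\<^sub>R x)))\<^sup>2 * (norm x powr (- \<alpha>) * \<rho> x) * k s) * indicator {0<..h} s \<partial>lborel \<partial>lborel)
    \<le> ennreal (\<integral>y. Z y \<partial>lborel)" .
  have Z: "(\<integral>y. Z y \<partial>lborel) = (h / (1 - h)) powr \<alpha> / \<alpha> * (\<integral>x. norm x powr (- \<alpha>) * (norm (F x))\<^sup>2 * \<rho> x \<partial>lborel)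
        - (h / D) powr \<alpha> / \<alpha> * (\<integral>x. (norm (F x))\<^sup>2 * \<rho> x \<partial>lborel)
        + M * D powr (\<beta> - \<alpha>) / (\<beta> - \<alpha>) * (\<integral>x. (norm (F x))\<^sup>2 \<partial>lborel)" (is "_ = ?Z")
    unfolding Z_def b_def by (simp add: int0 int1 int2)
  note le [unfolded Z]
  then show "(\<integral>\<^sup>+s. \<integral>\<^sup>+x. ennreal ((norm (F (s *\<^sub>R x)))\<^sup>2 * (norm x powr (- \<alpha>) * \<rho> x) * k s) * indicator {0<..h} s \<partial>lborel \<partial>lborel)
    \<le> ennreal ?Z" .
  show "0 \<le> ?Z" unfolding Z[symmetric] by (intro integral_nonneg_AE AE_I2 Z_nonneg)
qed

text \<open>The dilation hypothesis on \<open>\<rho>\<close> covers both parts of the theorem: \<open>M\<close> is the Hoelder constant, or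
  \<open>0\<close> if \<open>\<rho>\<close> is non-increasing along rays.\<close>

lemma kernel_form_lower_bound:
  assumes n: "2 \<le> DIM('a)" and \<alpha>: "0 < \<alpha>" "\<alpha> < (1::real)" and \<beta>: "\<alpha> < \<beta>" and M: "0 \<le> M"
    and F[measurable]: "F \<in> borel_measurable borel" and \<rho>_meas[measurable]: "\<rho> \<in> borel_measurable borel"
    and D: "0 < D"
    and SD: "\<And>x. x \<in> S \<Longrightarrow> norm x \<le> D" and S0: "0 \<notin> S"
    and FS: "\<And>x::'a::euclidean_space. x \<notin> S \<Longrightarrow> F x = (0::complex)"
    and \<rho>S: "\<And>x. x \<notin> S \<Longrightarrow> \<rho> x = 0"
    and \<rho>: "\<And>x. 0 \<le> \<rho> x" "\<And>x. \<rho> x \<le> R"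
    and hyp: "\<And>y s. y \<in> S \<Longrightarrow> 0 < s \<Longrightarrow> s < 1 \<Longrightarrow> y /\<^sub>R s \<in> S \<Longrightarrow>
        \<rho> (y /\<^sub>R s) \<le> \<rho> y + M * (norm y * (1 - s) / s) powr \<beta>"
    and int: "integrable lborel (\<lambda>x. norm x powr (- \<alpha>) * (norm (F x))\<^sup>2)"
    and J: "(\<integral>\<^sup>+x. \<integral>\<^sup>+s. ennreal (norm x powr (- \<alpha>) * (norm (F x) * norm (F x - F (s *\<^sub>R x))) *
      ((1 - s) powr (- \<alpha> - 1) * s ^ (DIM('a) - 1))) * indicator {0<..<1} s \<partial>lborel \<partial>lborel) < \<infinity>"
  defines "\<Phi> \<equiv> \<lambda>x s. F x * cnj (F x - F (s *\<^sub>R x)) *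
      of_real (norm x powr (- \<alpha>) * \<rho> x * ((1 - s) powr (- \<alpha> - 1) * s ^ (DIM('a) - 1)) * indicator {0<..<1} s)"
  defines "N \<equiv> \<integral>x. norm x powr (- \<alpha>) * (norm (F x))\<^sup>2 * \<rho> x \<partial>lborel"
  shows "integrable (lborel \<Otimes>\<^sub>M lborel) (case_prod \<Phi>)"
    and "- (fact (DIM('a) - 1) * Gamma (1 - \<alpha>) / (\<alpha> * Gamma (real DIM('a) - \<alpha>))) / 2 * N
        + D powr (- \<alpha>) / (2 * \<alpha>) * (\<integral>x. (norm (F x))\<^sup>2 * \<rho> x \<partial>lborel)
        - M * D powr (\<beta> - \<alpha>) / (2 * (\<beta> - \<alpha>)) * (\<integral>x. (norm (F x))\<^sup>2 \<partial>lborel)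
      \<le> Re (\<integral>x. \<integral>s. \<Phi> x s \<partial>lborel \<partial>lborel)"
proof -
  define k where "k s = (1 - s) powr (- \<alpha> - 1) * s ^ (DIM('a) - 1)" for s :: real
  define B where "B = fact (DIM('a) - 1) * Gamma (1 - \<alpha>) / (\<alpha> * Gamma (real DIM('a) - \<alpha>))"
  define N1 where "N1 = (\<integral>x. (norm (F x))\<^sup>2 * \<rho> x \<partial>lborel)"
  define N0 where "N0 = (\<integral>x. (norm (F x))\<^sup>2 \<partial>lborel)"
  define w where "w x = norm x powr (- \<alpha>) * \<rho> x" for x
  have [measurable]: "k \<in> borel_measurable borel" "w \<in> borel_measurable borel"
    by (auto simp: k_def[abs_def] w_def[abs_def])
  have w: "0 \<le> w x" for x using \<rho> by (simp add: w_def)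
  have [measurable]: "cnj \<in> borel_measurable borel" "(of_real :: real \<Rightarrow> complex) \<in> borel_measurable borel"
    by (intro borel_measurable_continuous_onI continuous_intros)+
  have [measurable]: "case_prod \<Phi> \<in> borel_measurable (lborel \<Otimes>\<^sub>M lborel)"
    unfolding \<Phi>_def by measurable
  show int\<Phi>: "integrable (lborel \<Otimes>\<^sub>M lborel) (case_prod \<Phi>)"
  proof (rule integrableI_bounded)
    have "(\<integral>\<^sup>+z. ennreal (norm (case_prod \<Phi> z)) \<partial>(lborel \<Otimes>\<^sub>M lborel))
      = (\<integral>\<^sup>+x. \<integral>\<^sup>+s. ennreal (norm (\<Phi> x s)) \<partial>lborel \<partial>lborel)"
      by (subst lborel.nn_integral_fst[symmetric]) auto
    also have "\<dots> \<le> (\<integral>\<^sup>+x. \<integral>\<^sup>+s. ennreal R * (ennreal (norm x powr (- \<alpha>) * (norm (F x) * norm (F x - F (s *\<^sub>R x))) * k s) * indicator {0<..<1} s) \<partial>lborel \<partial>lborel)"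
    proof (intro nn_integral_mono)
      fix x :: 'a and s :: real
      show "ennreal (norm (\<Phi> x s)) \<le> ennreal R * (ennreal (norm x powr (- \<alpha>) * (norm (F x) * norm (F x - F (s *\<^sub>R x))) * k s) * indicator {0<..<1} s)"
      proof (cases "s \<in> {0<..<1}")
        case True
        then have ks: "0 \<le> k s" by (simp add: k_def)
        have "norm (\<Phi> x s) = \<rho> x * (norm x powr (- \<alpha>) * (norm (F x) * norm (F x - F (s *\<^sub>R x))) * k s)"
          unfolding \<Phi>_def k_def[symmetric] norm_mult norm_of_real complex_mod_cnj
          using True ks \<rho>(1)[of x] by (simp add: abs_mult mult_ac)
        also have "\<dots> \<le> R * (norm x powr (- \<alpha>) * (norm (F x) * norm (F x - F (s *\<^sub>R x))) * k s)"
          using \<rho>(2) ks by (intro mult_right_mono) auto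
        finally have "ennreal (norm (\<Phi> x s)) \<le> ennreal \<dots>" by (rule ennreal_leI)
        then show ?thesis using True ks by (simp add: ennreal_mult''[symmetric])
      qed (simp add: \<Phi>_def)
    qed
    also have "\<dots> = ennreal R * (\<integral>\<^sup>+x. \<integral>\<^sup>+s. ennreal (norm x powr (- \<alpha>) * (norm (F x) * norm (F x - F (s *\<^sub>R x))) * k s) * indicator {0<..<1} s \<partial>lborel \<partial>lborel)"
      by (simp add: nn_integral_cmult)
    also have "\<dots> < \<infinity>"
      using J by (simp add: k_def ennreal_mult_less_top)
    finally show "(\<integral>\<^sup>+z. ennreal (norm (case_prod \<Phi> z)) \<partial>(lborel \<Otimes>\<^sub>M lborel)) < \<infinity>" .
  qed measurable
  \<comment> \<open>The part of the form with s \<le> h, on which the two halves can be integrated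
    separately.\<close>
  define T where "T h = (\<integral>z. Re (case_prod \<Phi> z) * indicator {0<..h} (snd z) \<partial>(lborel \<Otimes>\<^sub>M lborel))" for h :: real
  have intw: "integrable lborel (\<lambda>x. norm x powr (- \<alpha>) * (norm (F x))\<^sup>2 * \<rho> x)"
  proof (rule Bochner_Integration.integrable_bound[OF integrable_mult_right[OF int, of R]])
    have "\<rho> x \<le> \<bar>R\<bar>" for x using \<rho>(2)[of x] by linarith
    then show "AE x in lborel. norm (norm x powr (- \<alpha>) * (norm (F x))\<^sup>2 * \<rho> x) \<le> norm (R * (norm x powr (- \<alpha>) * (norm (F x))\<^sup>2))"
      using \<rho> by (auto simp: abs_mult mult.commute[of _ "\<rho> _"] intro!: AE_I2 mult_right_mono)
  qed simp
  have N: "0 \<le> N" unfolding N_def using \<rho> by (intro integral_nonneg_AE AE_I2) auto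
  have Nnn: "(\<integral>\<^sup>+x. ennreal ((norm (F x))\<^sup>2 * w x) \<partial>lborel) = ennreal N"
    unfolding N_def using intw \<rho>
    by (subst nn_integral_eq_integral[symmetric]) (auto simp: w_def mult_ac)
  have lower: "(- B - real (DIM('a) - 1) / \<alpha> * (1 - h) powr (1 - \<alpha>)) / 2 * N + (h / D) powr \<alpha> / (2 * \<alpha>) * N1
        - M * D powr (\<beta> - \<alpha>) / (2 * (\<beta> - \<alpha>)) * N0 \<le> T h" if h: "0 < h" "h < 1" for h
  proof -
    define b where "b = (h / (1 - h)) powr \<alpha> / \<alpha>"
    define Z where "Z = b * N - (h / D) powr \<alpha> / \<alpha> * N1 + M * D powr (\<beta> - \<alpha>) / (\<beta> - \<alpha>) * N0"
    let ?P1 = "\<lambda>z. (norm (F (fst z)))\<^sup>2 * w (fst z) * (k (snd z) * indicator {0<..h} (snd z))"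
    let ?P2 = "\<lambda>z. (norm (F (snd z *\<^sub>R fst z)))\<^sup>2 * w (fst z) * (k (snd z) * indicator {0<..h} (snd z))"
    have knn: "0 \<le> k s * indicator {0<..h} s" for s
      using h by (auto simp: k_def indicator_def)
    let ?K = "\<integral>\<^sup>+s. ennreal (k s * indicator {0<..h} s) \<partial>lborel"
    have "?K \<le> (\<integral>\<^sup>+s. ennreal ((1 - h) powr (- \<alpha> - 1)) * indicator {0..h} s \<partial>lborel)"
    proof (rule nn_integral_mono)
      fix s :: real
      have "k s \<le> (1 - h) powr (- \<alpha> - 1) * 1" if "0 < s" "s \<le> h"
        unfolding k_def using that h \<alpha>
        by (intro mult_mono powr_mono2' power_le_one) auto
      then show "ennreal (k s * indicator {0<..h} s) \<le> ennreal ((1 - h) powr (- \<alpha> - 1)) * indicator {0..h} s"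
        by (auto simp: indicator_def intro!: ennreal_leI)
    qed
    also have "\<dots> < \<infinity>"
      using h by (simp add: nn_integral_cmult_indicator ennreal_mult_less_top)
    finally obtain a where a: "?K = ennreal a" "0 \<le> a" by (cases ?K) auto
    \<comment> \<open>Both \<open>a\<close> and \<open>b\<close> grow like
      (1-h)^(-\<alpha>)/\<alpha>. The factor h^(n-1) in the lower bound for \<open>a\<close> is
      removed by Bernoulli's inequality, at the price of a multiple of (1-h)^(1-\<alpha>), which
      tends to 0 since \<alpha> < 1.\<close>
    have ab: "- B - real (DIM('a) - 1) / \<alpha> * (1 - h) powr (1 - \<alpha>) \<le> a - b"
    proof -
      have "(\<integral>\<^sup>+s. ennreal ((1 - s) powr (- \<alpha> - 1) * s ^ (DIM('a) - 1)) * indicator {0..h} s \<partial>lborel) = ?K"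
      proof (rule nn_integral_cong)
        fix s :: real
        show "ennreal ((1 - s) powr (- \<alpha> - 1) * s ^ (DIM('a) - 1)) * indicator {0..h} s = ennreal (k s * indicator {0<..h} s)"
          using n h by (cases "s = 0") (auto simp: k_def indicator_def)
      qed
      moreover have "0 \<le> B" unfolding B_def using \<alpha> n by (intro divide_nonneg_pos mult_nonneg_nonneg mult_pos_pos less_imp_le[OF Gamma_real_pos] Gamma_real_pos) auto
      ultimately have "h ^ (DIM('a) - 1) * (1 - h) powr (- \<alpha>) / \<alpha> \<le> a + B"
        using nn_integral_kernel_ge[OF h n \<alpha>, folded B_def] a(2)
        by (simp only: a(1) ennreal_plus[symmetric]) (subst (asm) ennreal_le_iff; simp)
      moreover have "b \<le> (1 - h) powr (- \<alpha>) / \<alpha>"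
      proof -
        have "(h / (1 - h)) powr \<alpha> \<le> (1 / (1 - h)) powr \<alpha>"
          using h \<alpha> by (intro powr_mono2) (auto simp: divide_right_mono)
        also have "\<dots> = (1 - h) powr (- \<alpha>)" using h by (simp add: powr_divide powr_minus_divide)
        finally show ?thesis unfolding b_def using \<alpha> by (intro divide_right_mono) auto
      qed
      moreover have "(1 - h) powr (- \<alpha>) / \<alpha> - h ^ (DIM('a) - 1) * (1 - h) powr (- \<alpha>) / \<alpha>
         \<le> real (DIM('a) - 1) / \<alpha> * (1 - h) powr (1 - \<alpha>)"
      proof -
        have "1 - real (DIM('a) - 1) * (1 - h) \<le> h ^ (DIM('a) - 1)"
          using Bernoulli_inequality[of "h - 1" "DIM('a) - 1"] h by (simp add: algebra_simps)
        then have "(1 - h ^ (DIM('a) - 1)) * ((1 - h) powr (- \<alpha>) / \<alpha>) \<le> (real (DIM('a) - 1) * (1 - h)) * ((1 - h) powr (- \<alpha>) / \<alpha>)"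
          using \<alpha> by (intro mult_right_mono) auto
        also have "\<dots> = real (DIM('a) - 1) / \<alpha> * ((1 - h) powr 1 * (1 - h) powr (- \<alpha>))"
          using h by simp
        also have "(1 - h) powr 1 * (1 - h) powr (- \<alpha>) = (1 - h) powr (1 - \<alpha>)"
          unfolding powr_add[symmetric] by simp
        finally show ?thesis by (simp add: left_diff_distrib diff_divide_distrib)
      qed
      ultimately show ?thesis by linarith
    qed
    have "(\<integral>\<^sup>+z. ennreal (?P1 z) \<partial>(lborel \<Otimes>\<^sub>M lborel)) = (\<integral>\<^sup>+x. \<integral>\<^sup>+s. ennreal ((norm (F x))\<^sup>2 * w x) * ennreal (k s * indicator {0<..h} s) \<partial>lborel \<partial>lborel)"
      by (subst lborel.nn_integral_fst[symmetric]) (use w in \<open>auto simp: ennreal_mult'[symmetric]\<close>)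
    also have "\<dots> = ennreal N * ennreal a"
      by (simp add: nn_integral_cmult nn_integral_multc a Nnn)
    also have "\<dots> = ennreal (N * a)" using N by (simp add: ennreal_mult')
    finally have P1: "integrable (lborel \<Otimes>\<^sub>M lborel) ?P1" "(\<integral>z. ?P1 z \<partial>(lborel \<Otimes>\<^sub>M lborel)) = N * a"
      using knn w N a by (subst (asm) nn_integral_eq_integrable; simp)+
    have "(\<integral>\<^sup>+z. ennreal (?P2 z) \<partial>(lborel \<Otimes>\<^sub>M lborel)) = (\<integral>\<^sup>+s. \<integral>\<^sup>+x. ennreal ((norm (F (s *\<^sub>R x)))\<^sup>2 * (norm x powr (- \<alpha>) * \<rho> x) * ((1 - s) powr (- \<alpha> - 1) * s ^ (DIM('a) - 1))) * indicator {0<..h} s \<partial>lborel \<partial>lborel)"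
      by (subst lborel_pair.nn_integral_snd[symmetric])
         (auto simp: w_def k_def indicator_def intro!: nn_integral_cong)
    also have "\<dots> \<le> ennreal Z" 
      unfolding Z_def b_def N_def N1_def N0_def
      by (rule nn_integral_dilated_le(1)[where S = S and R = R]; fact)
    finally have P2le: "(\<integral>\<^sup>+z. ennreal (?P2 z) \<partial>(lborel \<Otimes>\<^sub>M lborel)) \<le> ennreal Z" .
    have Z0: "0 \<le> Z"
      unfolding Z_def b_def N_def N1_def N0_def
      by (rule nn_integral_dilated_le(2)[where S = S and R = R]; fact)
    have P2nn: "0 \<le> ?P2 z" for z using knn w by simp
    have P2: "integrable (lborel \<Otimes>\<^sub>M lborel) ?P2"
      by (rule integrableI_nonneg) (use P2nn P2le in \<open>auto intro: le_less_trans\<close>)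
    have "ennreal (\<integral>z. ?P2 z \<partial>(lborel \<Otimes>\<^sub>M lborel)) \<le> ennreal Z"
      using P2le nn_integral_eq_integral[OF P2] P2nn by simp
    then have P2Z: "(\<integral>z. ?P2 z \<partial>(lborel \<Otimes>\<^sub>M lborel)) \<le> Z" using Z0 by simp
    have "(N * a - Z) / 2 \<le> (\<integral>z. ?P1 z / 2 - ?P2 z / 2 \<partial>(lborel \<Otimes>\<^sub>M lborel))"
      using P1 P2 P2Z by simp
    also have "\<dots> \<le> T h"
      unfolding T_def
    proof (rule integral_mono)
      show "integrable (lborel \<Otimes>\<^sub>M lborel) (\<lambda>z. ?P1 z / 2 - ?P2 z / 2)"
        using P1 P2 by simp
      show "integrable (lborel \<Otimes>\<^sub>M lborel) (\<lambda>z. Re (case_prod \<Phi> z) * indicator {0<..h} (snd z))"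
        by (rule Bochner_Integration.integrable_bound[OF int\<Phi>])
           (auto simp: indicator_def abs_Re_le_cmod)
      fix z :: "'a \<times> real"
      obtain x s where z: "z = (x, s)" by (cases z)
      let ?a = "F x" and ?b = "F (s *\<^sub>R x)"
      have "(norm ?a)\<^sup>2 / 2 - (norm ?b)\<^sup>2 / 2 \<le> Re (?a * cnj (?a - ?b))"
      proof -
        have "Re (?a * cnj (?a - ?b)) - ((norm ?a)\<^sup>2 / 2 - (norm ?b)\<^sup>2 / 2) = ((Re ?a - Re ?b)\<^sup>2 + (Im ?a - Im ?b)\<^sup>2) / 2"
          unfolding cmod_power2 by (simp add: power2_eq_square field_simps)
        moreover have "0 \<le> ((Re ?a - Re ?b)\<^sup>2 + (Im ?a - Im ?b)\<^sup>2) / 2" by simp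
        ultimately show ?thesis by linarith
      qed
      then have "((norm ?a)\<^sup>2 / 2 - (norm ?b)\<^sup>2 / 2) * (w x * (k s * indicator {0<..h} s)) \<le> Re (?a * cnj (?a - ?b)) * (w x * (k s * indicator {0<..h} s))"
        using w knn by (intro mult_right_mono) auto
      moreover have "Re (\<Phi> x s) * indicator {0<..h} s = Re (?a * cnj (?a - ?b)) * (w x * (k s * indicator {0<..h} s))"
        unfolding \<Phi>_def using h by (auto simp: indicator_def w_def k_def)
      ultimately show "?P1 z / 2 - ?P2 z / 2 \<le> Re (case_prod \<Phi> z) * indicator {0<..h} (snd z)"
        by (simp add: z algebra_simps)
    qed
    finally have "(N * a - Z) / 2 \<le> T h" .
    moreover have "(- B - real (DIM('a) - 1) / \<alpha> * (1 - h) powr (1 - \<alpha>)) * N \<le> (a - b) * N"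
      by (rule mult_right_mono[OF ab N])
    moreover have "(N * a - Z) / 2 = (a - b) * N / 2 + (h / D) powr \<alpha> / (2 * \<alpha>) * N1 - M * D powr (\<beta> - \<alpha>) / (2 * (\<beta> - \<alpha>)) * N0"
      using \<alpha> \<beta> by (simp add: Z_def field_simps)
    ultimately show ?thesis by argo
  qed
  \<comment> \<open>The shift by 2 keeps every \<open>h m\<close> strictly between 0 and 1.\<close>
  define h where "h m = 1 - 1 / real (m + 2)" for m :: nat
  have h: "0 < h m" "h m < 1" for m by (auto simp: h_def)
  have hlim: "h \<longlonglongrightarrow> 1"
  proof -
    have "(\<lambda>m. 1 - 1 / real (m + 2)) \<longlonglongrightarrow> 1 - 0"
      by (intro tendsto_diff tendsto_const LIMSEQ_ignore_initial_segment[OF lim_1_over_n, of 2, unfolded of_nat_add, simplified]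
           LIMSEQ_ignore_initial_segment[of "\<lambda>m. 1 / real m"] lim_1_over_n)
    then show ?thesis by (simp add: h_def[abs_def])
  qed
  have "(\<lambda>m. T (h m)) \<longlonglongrightarrow> (\<integral>z. Re (case_prod \<Phi> z) \<partial>(lborel \<Otimes>\<^sub>M lborel))"
    unfolding T_def
  \<comment> \<open>The full form, absolutely integrable by \<open>J\<close>, dominates its cut-off
    parts.\<close>
  proof (rule integral_dominated_convergence[where w="\<lambda>z. norm (case_prod \<Phi> z)"])
    show "AE z in lborel \<Otimes>\<^sub>M lborel. (\<lambda>m. Re (case_prod \<Phi> z) * indicator {0<..h m} (snd z)) \<longlonglongrightarrow> Re (case_prod \<Phi> z)"
    proof (rule AE_I2)
      fix z :: "'a \<times> real"
      obtain x s where z: "z = (x, s)" by (cases z)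
      show "(\<lambda>m. Re (case_prod \<Phi> z) * indicator {0<..h m} (snd z)) \<longlonglongrightarrow> Re (case_prod \<Phi> z)"
      proof (cases "0 < s \<and> s < 1")
        case True
        then have "eventually (\<lambda>m. s < h m) sequentially"
          using hlim by (auto dest: order_tendstoD)
        then have "eventually (\<lambda>m. Re (case_prod \<Phi> z) * indicator {0<..h m} (snd z) = Re (case_prod \<Phi> z)) sequentially"
          by eventually_elim (use True in \<open>auto simp: z\<close>)
        then show ?thesis by (rule tendsto_eventually)
      next
        case False
        then have "\<Phi> x s = 0" by (auto simp: \<Phi>_def indicator_def)
        then show ?thesis by (simp add: z)
      qed
    qed
    show "AE z in lborel \<Otimes>\<^sub>M lborel. norm (Re (case_prod \<Phi> z) * indicator {0<..h m} (snd z)) \<le> norm (case_prod \<Phi> z)" for m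
      by (auto simp: indicator_def abs_Re_le_cmod)
  qed (use int\<Phi> in auto)
  moreover have "(\<lambda>m. (- B - real (DIM('a) - 1) / \<alpha> * (1 - h m) powr (1 - \<alpha>)) / 2 * N + (h m / D) powr \<alpha> / (2 * \<alpha>) * N1
        - M * D powr (\<beta> - \<alpha>) / (2 * (\<beta> - \<alpha>)) * N0)
     \<longlonglongrightarrow> (- B - real (DIM('a) - 1) / \<alpha> * 0) / 2 * N + (1 / D) powr \<alpha> / (2 * \<alpha>) * N1
        - M * D powr (\<beta> - \<alpha>) / (2 * (\<beta> - \<alpha>)) * N0"
  proof -
    have "(\<lambda>m. 1 - h m) \<longlonglongrightarrow> 0"
      using tendsto_diff[OF tendsto_const[of 1] hlim] by simp
    then have "(\<lambda>m. (1 - h m) powr (1 - \<alpha>)) \<longlonglongrightarrow> 0 powr (1 - \<alpha>)"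
      using h(2) \<alpha> by (intro tendsto_powr' tendsto_const) (auto intro!: always_eventually less_imp_le)
    then have 1: "(\<lambda>m. (1 - h m) powr (1 - \<alpha>)) \<longlonglongrightarrow> 0" by simp
    have 2: "(\<lambda>m. (h m / D) powr \<alpha>) \<longlonglongrightarrow> (1 / D) powr \<alpha>"
      using D by (intro tendsto_powr tendsto_divide hlim tendsto_const) auto
    show ?thesis using \<alpha> by (intro tendsto_intros 1 2) auto
  qed
  ultimately have "(- B - real (DIM('a) - 1) / \<alpha> * 0) / 2 * N + (1 / D) powr \<alpha> / (2 * \<alpha>) * N1
        - M * D powr (\<beta> - \<alpha>) / (2 * (\<beta> - \<alpha>)) * N0 \<le> (\<integral>z. Re (case_prod \<Phi> z) \<partial>(lborel \<Otimes>\<^sub>M lborel))"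
    using lower h by (intro LIMSEQ_le) auto
  also have "\<dots> = Re (\<integral>z. case_prod \<Phi> z \<partial>(lborel \<Otimes>\<^sub>M lborel))"
    using int\<Phi> by simp
  also have "(\<integral>z. case_prod \<Phi> z \<partial>(lborel \<Otimes>\<^sub>M lborel)) = (\<integral>x. \<integral>s. \<Phi> x s \<partial>lborel \<partial>lborel)"
    by (rule lborel_pair.integral_fst[symmetric, OF int\<Phi>])
  also have "(1 / D) powr \<alpha> = D powr (- \<alpha>)"
    using D by (simp add: powr_divide powr_minus_divide)
  finally show "- (fact (DIM('a) - 1) * Gamma (1 - \<alpha>) / (\<alpha> * Gamma (real DIM('a) - \<alpha>))) / 2 * N
        + D powr (- \<alpha>) / (2 * \<alpha>) * (\<integral>x. (norm (F x))\<^sup>2 * \<rho> x \<partial>lborel)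
        - M * D powr (\<beta> - \<alpha>) / (2 * (\<beta> - \<alpha>)) * (\<integral>x. (norm (F x))\<^sup>2 \<partial>lborel)
      \<le> Re (\<integral>x. \<integral>s. \<Phi> x s \<partial>lborel \<partial>lborel)"
    by (simp add: B_def N1_def N0_def)
qed

section \<open>Approximation by test functions\<close>

lemma partial_deriv_sum:
  assumes "\<phi> differentiable (at x)"
  shows "frechet_derivative \<phi> (at x) h = (\<Sum>i\<in>Basis. (h \<bullet> i) *\<^sub>R partial_deriv i \<phi> x)"
proof -
  interpret linear "frechet_derivative \<phi> (at x)"
    by (rule linear_frechet_derivative[OF assms])
  have "frechet_derivative \<phi> (at x) h = frechet_derivative \<phi> (at x) (\<Sum>i\<in>Basis. (h \<bullet> i) *\<^sub>R i)"
    by (simp add: euclidean_representation)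
  then show ?thesis by (simp add: sum scaleR partial_deriv_def)
qed

text \<open>The fundamental theorem of calculus along the ray, then Cauchy-Schwarz twice: over
  [s,1], for the factor 1 - s, and over the coordinates, for |x|^2. This supplies \<open>seg\<close>
  in the earlier estimates, with \<open>v\<close> the squared gradient length.\<close>

lemma segment_difference_bound:
  fixes \<phi> :: "'a::euclidean_space \<Rightarrow> complex"
  assumes d: "\<And>x. \<phi> differentiable (at x)" and c: "\<And>i. i \<in> Basis \<Longrightarrow> continuous_on UNIV (partial_deriv i \<phi>)"
    and s: "0 < s" "s < (1::real)"
  shows "ennreal ((norm (\<phi> (P + x) - \<phi> (P + s *\<^sub>R x)))\<^sup>2)
    \<le> ennreal ((1 - s) * (norm x)\<^sup>2) *
       (\<integral>\<^sup>+\<tau>\<in>{s..1}. ennreal (\<Sum>i\<in>Basis. (norm (partial_deriv i \<phi> (P + \<tau> *\<^sub>R x)))\<^sup>2) \<partial>lborel)"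
proof -
  define h' where "h' \<tau> = (\<Sum>i\<in>Basis. (x \<bullet> i) *\<^sub>R partial_deriv i \<phi> (P + \<tau> *\<^sub>R x))" for \<tau>
  define v where "v \<tau> = (\<Sum>i\<in>Basis. (norm (partial_deriv i \<phi> (P + \<tau> *\<^sub>R x)))\<^sup>2)" for \<tau>
  have cont: "continuous_on UNIV (\<lambda>\<tau>. partial_deriv i \<phi> (P + \<tau> *\<^sub>R x))" if "i \<in> Basis" for i
    by (rule continuous_on_compose2[OF c[OF that]]) (auto intro!: continuous_intros)
  have ch': "continuous_on UNIV h'"
    unfolding h'_def[abs_def] by (intro continuous_intros cont)
  have "continuous_on UNIV v"
    unfolding v_def[abs_def] by (intro continuous_intros cont)
  with ch' have [measurable]: "h' \<in> borel_measurable borel" "v \<in> borel_measurable borel"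
    by (auto intro: borel_measurable_continuous_onI)
  have vd: "((\<lambda>\<tau>. \<phi> (P + \<tau> *\<^sub>R x)) has_vector_derivative h' \<tau>) (at \<tau> within {s..1})" for \<tau>
  proof -
    have "(\<phi> has_derivative frechet_derivative \<phi> (at (P + \<tau> *\<^sub>R x))) (at (P + \<tau> *\<^sub>R x) within UNIV)"
      using d frechet_derivative_works by auto
    moreover have "((\<lambda>\<tau>. P + \<tau> *\<^sub>R x) has_vector_derivative x) (at \<tau> within {s..1})"
      by (auto intro!: derivative_eq_intros simp: has_vector_derivative_def)
    ultimately have "(\<phi> \<circ> (\<lambda>\<tau>. P + \<tau> *\<^sub>R x) has_vector_derivative frechet_derivative \<phi> (at (P + \<tau> *\<^sub>R x)) x) (at \<tau> within {s..1})"
      by (intro vector_derivative_diff_chain_within) (auto intro: has_derivative_subset)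
    then show ?thesis by (simp add: o_def h'_def partial_deriv_sum[OF d])
  qed
  have bi: "has_bochner_integral lborel (\<lambda>\<tau>. indicator {s..1} \<tau> *\<^sub>R h' \<tau>) (\<phi> (P + 1 *\<^sub>R x) - \<phi> (P + s *\<^sub>R x))"
    using s by (intro has_bochner_integral_FTC_Icc vd continuous_on_subset[OF ch']) auto
  then have "ennreal (norm (\<phi> (P + x) - \<phi> (P + s *\<^sub>R x))) \<le> (\<integral>\<^sup>+\<tau>. ennreal (norm (indicator {s..1} \<tau> *\<^sub>R h' \<tau>)) \<partial>lborel)"
    using integral_norm_bound_ennreal[of lborel "\<lambda>\<tau>. indicator {s..1} \<tau> *\<^sub>R h' \<tau>"]
    by (simp add: has_bochner_integral_iff)
  \<comment> \<open>The indicator is doubled so that one copy can serve as a factor in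
    Cauchy-Schwarz, where its square integrates to 1 - s.\<close>
  also have "\<dots> = (\<integral>\<^sup>+\<tau>. indicator {s..1} \<tau> * (ennreal (norm (h' \<tau>)) * indicator {s..1} \<tau>) \<partial>lborel)"
    by (intro nn_integral_cong) (auto simp: indicator_def)
  finally have "(ennreal (norm (\<phi> (P + x) - \<phi> (P + s *\<^sub>R x))))\<^sup>2
     \<le> (\<integral>\<^sup>+\<tau>. indicator {s..1} \<tau> * (ennreal (norm (h' \<tau>)) * indicator {s..1} \<tau>) \<partial>lborel)\<^sup>2"
    by (rule power_mono) simp
  also have "\<dots> \<le> (\<integral>\<^sup>+\<tau>. (indicator {s..1} \<tau>)\<^sup>2 \<partial>lborel) * (\<integral>\<^sup>+\<tau>. (ennreal (norm (h' \<tau>)) * indicator {s..1} \<tau>)\<^sup>2 \<partial>lborel)"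
    by (rule Cauchy_Schwarz_nn_integral) measurable
  also have "(\<integral>\<^sup>+\<tau>. (indicator {s..1} \<tau>)\<^sup>2 \<partial>lborel) = ennreal (1 - s)"
  proof -
    have "(\<integral>\<^sup>+\<tau>. (indicator {s..1} \<tau>)\<^sup>2 \<partial>lborel) = (\<integral>\<^sup>+\<tau>. indicator {s..1} \<tau> \<partial>lborel)"
      by (intro nn_integral_cong) (auto simp: indicator_def)
    then show ?thesis using s by simp
  qed
  finally have 1: "(ennreal (norm (\<phi> (P + x) - \<phi> (P + s *\<^sub>R x))))\<^sup>2
     \<le> ennreal (1 - s) * (\<integral>\<^sup>+\<tau>. (ennreal (norm (h' \<tau>)) * indicator {s..1} \<tau>)\<^sup>2 \<partial>lborel)" .
  have "(\<integral>\<^sup>+\<tau>. (ennreal (norm (h' \<tau>)) * indicator {s..1} \<tau>)\<^sup>2 \<partial>lborel)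
     \<le> (\<integral>\<^sup>+\<tau>. ennreal ((norm x)\<^sup>2) * (ennreal (v \<tau>) * indicator {s..1} \<tau>) \<partial>lborel)"
  proof (rule nn_integral_mono)
    fix \<tau> :: real
    have "norm (h' \<tau>) \<le> (\<Sum>i\<in>Basis. \<bar>x \<bullet> i\<bar> * norm (partial_deriv i \<phi> (P + \<tau> *\<^sub>R x)))"
      unfolding h'_def by (rule order_trans[OF norm_sum]) simp
    then have "(norm (h' \<tau>))\<^sup>2 \<le> (\<Sum>i\<in>Basis. \<bar>x \<bullet> i\<bar> * norm (partial_deriv i \<phi> (P + \<tau> *\<^sub>R x)))\<^sup>2"
      by (rule power_mono) simp
    also have "\<dots> \<le> (\<Sum>i\<in>Basis. \<bar>x \<bullet> i\<bar>\<^sup>2) * v \<tau>"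
      unfolding v_def by (rule Cauchy_Schwarz_ineq_sum)
    also have "(\<Sum>i\<in>Basis. \<bar>x \<bullet> i\<bar>\<^sup>2) = (norm x)\<^sup>2"
      unfolding power2_norm_eq_inner by (subst euclidean_inner) (simp add: power2_eq_square)
    finally have "ennreal ((norm (h' \<tau>))\<^sup>2) \<le> ennreal ((norm x)\<^sup>2 * v \<tau>)" by (rule ennreal_leI)
    then show "(ennreal (norm (h' \<tau>)) * indicator {s..1} \<tau>)\<^sup>2 \<le> ennreal ((norm x)\<^sup>2) * (ennreal (v \<tau>) * indicator {s..1} \<tau>)"
      by (auto simp: indicator_def ennreal_power ennreal_mult')
  qed
  also have "(\<integral>\<^sup>+\<tau>. ennreal ((norm x)\<^sup>2) * (ennreal (v \<tau>) * indicator {s..1} \<tau>) \<partial>lborel)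
     = ennreal ((norm x)\<^sup>2) * (\<integral>\<^sup>+\<tau>\<in>{s..1}. ennreal (v \<tau>) \<partial>lborel)"
    by (rule nn_integral_cmult) measurable
  finally have 2: "(\<integral>\<^sup>+\<tau>. (ennreal (norm (h' \<tau>)) * indicator {s..1} \<tau>)\<^sup>2 \<partial>lborel)
     \<le> ennreal ((norm x)\<^sup>2) * (\<integral>\<^sup>+\<tau>\<in>{s..1}. ennreal (v \<tau>) \<partial>lborel)" .
  have "ennreal ((norm (\<phi> (P + x) - \<phi> (P + s *\<^sub>R x)))\<^sup>2) = (ennreal (norm (\<phi> (P + x) - \<phi> (P + s *\<^sub>R x))))\<^sup>2"
    by (simp add: ennreal_power)
  also note order_trans[OF 1 mult_left_mono[OF 2]]
  also have "ennreal (1 - s) * (ennreal ((norm x)\<^sup>2) * (\<integral>\<^sup>+\<tau>\<in>{s..1}. ennreal (v \<tau>) \<partial>lborel))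
    = ennreal ((1 - s) * (norm x)\<^sup>2) * (\<integral>\<^sup>+\<tau>\<in>{s..1}. ennreal (v \<tau>) \<partial>lborel)"
    using s by (simp add: ennreal_mult' mult.assoc)
  finally show ?thesis by (simp add: v_def)
qed

text \<open>The derivatives vanish off the domain because the complement of the closed support is
  open. The last property keeps a test function away from the singularity of |y|^(-\<alpha>) at
  \<open>P\<close>; the Hardy argument takes its a priori finiteness from it.\<close>

lemma test_functionsD:
  assumes "\<phi> \<in> test_functions \<Omega>"
  shows "\<phi> differentiable (at x)" "continuous_on UNIV \<phi>"
    and "i \<in> Basis \<Longrightarrow> continuous_on UNIV (partial_deriv i \<phi>)"
    and "x \<notin> \<Omega> \<Longrightarrow> \<phi> x = 0" "x \<notin> \<Omega> \<Longrightarrow> partial_deriv i \<phi> x = 0"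
    and "P \<notin> \<Omega> \<Longrightarrow> \<exists>\<delta>>0. \<forall>y. norm y < \<delta> \<longrightarrow> \<phi> (P + y) = 0"
proof -
  define K where "K = closure {x. \<phi> x \<noteq> 0}"
  have ck: "\<And>k. Ck k \<phi>" and K: "K \<subseteq> \<Omega>" using assms by (auto simp: test_functions_def K_def)
  show d: "\<phi> differentiable (at x)" for x using ck[of "Suc 0"] by simp
  show "continuous_on UNIV \<phi>" using ck[of 0] by simp
  show "i \<in> Basis \<Longrightarrow> continuous_on UNIV (partial_deriv i \<phi>)" using ck[of "Suc 0"] by simp
  have z: "\<phi> x = 0" if "x \<notin> K" for x using that closure_subset[of "{x. \<phi> x \<noteq> 0}"] unfolding K_def by blast
  then show "\<phi> x = 0" if "x \<notin> \<Omega>" using that K by blast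
  have open_K: "open (- K)" unfolding K_def by (simp add: open_Compl)
  show "partial_deriv i \<phi> x = 0" if "x \<notin> \<Omega>"
  proof -
    have x: "x \<in> - K" using that K by auto
    have "(\<phi> has_derivative (\<lambda>_. 0)) (at x)"
      by (rule has_derivative_transform_within_open[where f = "\<lambda>_. 0", OF has_derivative_const open_K x]) (simp add: z)
    then have "frechet_derivative \<phi> (at x) = (\<lambda>_. 0)" by (rule frechet_derivative_at[symmetric])
    then show ?thesis by (simp add: partial_deriv_def)
  qed
  show "\<exists>\<delta>>0. \<forall>y. norm y < \<delta> \<longrightarrow> \<phi> (P + y) = 0" if "P \<notin> \<Omega>"
  proof -
    have "P \<in> - K" using that K by auto
    then obtain \<delta> where "0 < \<delta>" "ball P \<delta> \<subseteq> - K" using open_K unfolding open_contains_ball by blast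
    moreover have "P + y \<in> ball P \<delta>" if "norm y < \<delta>" for y using that by (simp add: dist_norm)
    ultimately show ?thesis using z by blast
  qed
qed

text \<open>The second estimate serves to bound the gradients of approximating test functions by the
  weak gradient of the limit and the distance to it.\<close>

lemma L2_diff:
  assumes f: "f \<in> L2 \<Omega>" and g: "g \<in> L2 \<Omega>"
  shows "(\<lambda>x. f x - g x) \<in> L2 \<Omega>"
    and "(LINT x:\<Omega>|lebesgue. (norm (g x))\<^sup>2)
      \<le> 2 * (LINT x:\<Omega>|lebesgue. (norm (f x))\<^sup>2) + 2 * (LINT x:\<Omega>|lebesgue. (norm (f x - g x))\<^sup>2)"
proof -
  have m: "(\<lambda>x. indicator \<Omega> x *\<^sub>R f x) \<in> borel_measurable lebesgue" "(\<lambda>x. indicator \<Omega> x *\<^sub>R g x) \<in> borel_measurable lebesgue"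
    and i: "integrable lebesgue (\<lambda>x. indicator \<Omega> x *\<^sub>R (norm (f x))\<^sup>2)" "integrable lebesgue (\<lambda>x. indicator \<Omega> x *\<^sub>R (norm (g x))\<^sup>2)"
    using f g by (auto simp: L2_def set_borel_measurable_def set_integrable_def)
  have md: "(\<lambda>x. indicator \<Omega> x *\<^sub>R (f x - g x)) \<in> borel_measurable lebesgue"
    using borel_measurable_diff[OF m] by (simp add: scaleR_diff_right)
  have e: "indicator \<Omega> x *\<^sub>R (norm (f x - g x))\<^sup>2 = (norm (indicator \<Omega> x *\<^sub>R (f x - g x)))\<^sup>2" for x
    by (auto simp: indicator_def)
  have tri: "(norm (a + b))\<^sup>2 \<le> 2 * (norm a)\<^sup>2 + 2 * (norm b)\<^sup>2" for a b :: complex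
  proof -
    have "(norm (a + b))\<^sup>2 \<le> (norm a + norm b)\<^sup>2" by (intro power_mono norm_triangle_ineq) simp
    also have "\<dots> \<le> 2 * (norm a)\<^sup>2 + 2 * (norm b)\<^sup>2"
      using sum_squares_bound[of "norm a" "norm b"] by (simp add: power2_sum)
    finally show ?thesis .
  qed
  have id: "integrable lebesgue (\<lambda>x. indicator \<Omega> x *\<^sub>R (norm (f x - g x))\<^sup>2)"
  proof (rule Bochner_Integration.integrable_bound)
    show "integrable lebesgue (\<lambda>x. 2 * (indicator \<Omega> x *\<^sub>R (norm (f x))\<^sup>2) + 2 * (indicator \<Omega> x *\<^sub>R (norm (g x))\<^sup>2))"
      using i by auto
    show "(\<lambda>x. indicator \<Omega> x *\<^sub>R (norm (f x - g x))\<^sup>2) \<in> borel_measurable lebesgue"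
      unfolding e using md by measurable
    show "AE x in lebesgue. norm (indicator \<Omega> x *\<^sub>R (norm (f x - g x))\<^sup>2)
      \<le> norm (2 * (indicator \<Omega> x *\<^sub>R (norm (f x))\<^sup>2) + 2 * (indicator \<Omega> x *\<^sub>R (norm (g x))\<^sup>2))"
    proof (rule AE_I2)
      fix x show "norm (indicator \<Omega> x *\<^sub>R (norm (f x - g x))\<^sup>2)
        \<le> norm (2 * (indicator \<Omega> x *\<^sub>R (norm (f x))\<^sup>2) + 2 * (indicator \<Omega> x *\<^sub>R (norm (g x))\<^sup>2))"
        using tri[of "f x" "- g x"] by (auto simp: indicator_def)
    qed
  qed
  show "(\<lambda>x. f x - g x) \<in> L2 \<Omega>"
    using md id by (simp add: L2_def set_borel_measurable_def set_integrable_def)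
  show "(LINT x:\<Omega>|lebesgue. (norm (g x))\<^sup>2)
      \<le> 2 * (LINT x:\<Omega>|lebesgue. (norm (f x))\<^sup>2) + 2 * (LINT x:\<Omega>|lebesgue. (norm (f x - g x))\<^sup>2)"
  proof -
    have "(LINT x:\<Omega>|lebesgue. (norm (g x))\<^sup>2)
      \<le> (\<integral>x. 2 * (indicator \<Omega> x *\<^sub>R (norm (f x))\<^sup>2) + 2 * (indicator \<Omega> x *\<^sub>R (norm (f x - g x))\<^sup>2) \<partial>lebesgue)"
      unfolding set_lebesgue_integral_def
    proof (rule integral_mono)
      fix x show "indicator \<Omega> x *\<^sub>R (norm (g x))\<^sup>2 \<le> 2 * (indicator \<Omega> x *\<^sub>R (norm (f x))\<^sup>2) + 2 * (indicator \<Omega> x *\<^sub>R (norm (f x - g x))\<^sup>2)"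
        using tri[of "f x" "g x - f x"] by (auto simp: indicator_def norm_minus_commute)
    qed (use i id in auto)
    then show ?thesis using i id by (simp add: set_lebesgue_integral_def)
  qed
qed

lemma continuous_L2:
  fixes \<Omega> :: "'a::euclidean_space set"
  assumes "open \<Omega>" "bounded \<Omega>" and c: "continuous_on UNIV g"
  shows "g \<in> L2 \<Omega>"
proof -
  have [measurable]: "\<Omega> \<in> sets lebesgue" using assms(1) by (simp add: lmeasurable_open)
  have g: "g \<in> borel_measurable lebesgue"
    using borel_measurable_continuous_onI[OF c] by (simp add: measurable_completion)
  have "bounded (g ` closure \<Omega>)"
    using assms by (intro compact_imp_bounded compact_continuous_image continuous_on_subset[OF c]) auto
  then obtain B where B: "\<And>x. x \<in> closure \<Omega> \<Longrightarrow> norm (g x) \<le> B"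
    unfolding bounded_iff by blast
  have "integrable lebesgue (\<lambda>x. indicator \<Omega> x *\<^sub>R (norm (g x))\<^sup>2)"
  proof (rule integrableI_bounded_set_indicator[where B = "B\<^sup>2"])
    show "emeasure lebesgue \<Omega> < \<infinity>"
      using assms emeasure_bounded_finite[of \<Omega>] by (simp add: emeasure_completion)
    show "AE x in lebesgue. x \<in> \<Omega> \<longrightarrow> norm ((norm (g x))\<^sup>2) \<le> B\<^sup>2"
      using B closure_subset[of \<Omega>] by (auto intro!: AE_I2 power_mono)
  qed (use g in measurable)
  then show ?thesis
    using g by (simp add: L2_def set_borel_measurable_def set_integrable_def)
qed

text \<open>This is all that Fatou's lemma asks of membership in \<open>H10\<close>: almost
  everywhere convergence of test functions whose gradients stay bounded in the mean square. The
  later estimates see the weak gradient only through the number \<open>G\<close>.\<close>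

lemma H10_approximation:
  fixes \<Omega> :: "'a::euclidean_space set"
  assumes \<Omega>: "open \<Omega>" "bounded \<Omega>" and f: "f \<in> H10 \<Omega>"
  obtains \<phi> :: "nat \<Rightarrow> 'a \<Rightarrow> complex" and G :: real where "\<And>k. \<phi> k \<in> test_functions \<Omega>" "0 \<le> G"
    "\<And>k. (\<integral>\<^sup>+x. ennreal (\<Sum>i\<in>Basis. (norm (partial_deriv i (\<phi> k) x))\<^sup>2) \<partial>lborel) \<le> ennreal G"
    "AE x in lborel. x \<in> \<Omega> \<longrightarrow> (\<lambda>k. \<phi> k x) \<longlonglongrightarrow> f x"
proof -
  obtain g where fL2: "f \<in> L2 \<Omega>" and wg: "weak_gradient \<Omega> f g"
    and approx: "\<And>\<epsilon>. \<epsilon> > 0 \<Longrightarrow> \<exists>\<phi>\<in>test_functions \<Omega>. H1_norm \<Omega> (\<lambda>x. f x - \<phi> x) (\<lambda>i x. g i x - partial_deriv i \<phi> x) < \<epsilon>"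
    using f by (auto simp: H10_def)
  have gL2: "g i \<in> L2 \<Omega>" if "i \<in> Basis" for i using wg that by (simp add: weak_gradient_def)
  obtain \<psi> where \<psi>: "\<And>k. \<psi> k \<in> test_functions \<Omega>"
    and H1: "\<And>k. H1_norm \<Omega> (\<lambda>x. f x - \<psi> k x) (\<lambda>i x. g i x - partial_deriv i (\<psi> k) x) < 1 / real (Suc k)"
  proof -
    have "\<exists>\<phi>. \<phi> \<in> test_functions \<Omega> \<and> H1_norm \<Omega> (\<lambda>x. f x - \<phi> x) (\<lambda>i x. g i x - partial_deriv i \<phi> x) < 1 / real (Suc k)" for k
      using approx[of "1 / real (Suc k)"] by auto
    then show ?thesis using that by metis
  qed
  note t = test_functionsD[OF \<psi>]
  have \<psi>L2: "\<psi> k \<in> L2 \<Omega>" for k by (rule continuous_L2[OF \<Omega> t(2)])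
  have d\<psi>L2: "partial_deriv i (\<psi> k) \<in> L2 \<Omega>" if "i \<in> Basis" for i k by (rule continuous_L2[OF \<Omega> t(3)[OF that]])
  let ?A = "\<lambda>k. LINT x:\<Omega>|lebesgue. (norm (f x - \<psi> k x))\<^sup>2"
  let ?B = "\<lambda>k i. LINT x:\<Omega>|lebesgue. (norm (g i x - partial_deriv i (\<psi> k) x))\<^sup>2"
  have nonneg: "0 \<le> (LINT x:\<Omega>|lebesgue. (norm (h x))\<^sup>2)" for h :: "'a \<Rightarrow> complex"
    unfolding set_lebesgue_integral_def by (intro integral_nonneg_AE AE_I2) simp
  have sum: "?A k + (\<Sum>i\<in>Basis. ?B k i) < 1 / real (Suc k)" for k
  proof -
    have "sqrt (?A k + (\<Sum>i\<in>Basis. ?B k i)) < 1 / real (Suc k)"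
      using H1[of k] by (simp add: H1_norm_def)
    moreover have X: "0 \<le> ?A k + (\<Sum>i\<in>Basis. ?B k i)" by (intro add_nonneg_nonneg sum_nonneg nonneg)
    ultimately have "(sqrt (?A k + (\<Sum>i\<in>Basis. ?B k i)))\<^sup>2 < (1 / real (Suc k))\<^sup>2"
      by (intro power_strict_mono) auto
    then have "?A k + (\<Sum>i\<in>Basis. ?B k i) < (1 / real (Suc k))\<^sup>2"
      using X by (simp only: real_sqrt_pow2)
    also have "\<dots> \<le> (1 / real (Suc k)) ^ 1"
      by (intro power_decreasing) auto
    finally show ?thesis by simp
  qed
  \<comment> \<open>The summand 2 absorbs twice the squared gradient distance, which is below
    1/(k+1).\<close>
  define G where "G = 2 * (\<Sum>i\<in>Basis. LINT x:\<Omega>|lebesgue. (norm (g i x))\<^sup>2) + 2"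
  have G: "0 \<le> G" unfolding G_def by (intro add_nonneg_nonneg mult_nonneg_nonneg sum_nonneg nonneg) auto
  have grad: "(\<integral>\<^sup>+x. ennreal (\<Sum>i\<in>Basis. (norm (partial_deriv i (\<psi> k) x))\<^sup>2) \<partial>lborel) \<le> ennreal G" for k
  proof -
    have int: "integrable lebesgue (\<lambda>x. indicator \<Omega> x *\<^sub>R (norm (partial_deriv i (\<psi> k) x))\<^sup>2)" if "i \<in> Basis" for i
      using d\<psi>L2[OF that] by (simp add: L2_def set_integrable_def)
    have m: "(\<lambda>x. ennreal (\<Sum>i\<in>Basis. (norm (partial_deriv i (\<psi> k) x))\<^sup>2)) \<in> borel_measurable lborel"
      using borel_measurable_continuous_onI[OF t(3)] by measurable
    have "(\<integral>\<^sup>+x. ennreal (\<Sum>i\<in>Basis. (norm (partial_deriv i (\<psi> k) x))\<^sup>2) \<partial>lborel)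
      = (\<integral>\<^sup>+x. ennreal (\<Sum>i\<in>Basis. (norm (partial_deriv i (\<psi> k) x))\<^sup>2) \<partial>lebesgue)"
      using m by (simp add: nn_integral_completion)
    also have "\<dots> = (\<integral>\<^sup>+x. ennreal (\<Sum>i\<in>Basis. indicator \<Omega> x *\<^sub>R (norm (partial_deriv i (\<psi> k) x))\<^sup>2) \<partial>lebesgue)"
    proof (rule nn_integral_cong)
      fix x show "ennreal (\<Sum>i\<in>Basis. (norm (partial_deriv i (\<psi> k) x))\<^sup>2) = ennreal (\<Sum>i\<in>Basis. indicator \<Omega> x *\<^sub>R (norm (partial_deriv i (\<psi> k) x))\<^sup>2)"
        by (cases "x \<in> \<Omega>") (simp_all add: t(5))
    qed
    also have "\<dots> = ennreal (\<integral>x. (\<Sum>i\<in>Basis. indicator \<Omega> x *\<^sub>R (norm (partial_deriv i (\<psi> k) x))\<^sup>2) \<partial>lebesgue)"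
      by (intro nn_integral_eq_integral Bochner_Integration.integrable_sum int AE_I2 sum_nonneg) auto
    also have "(\<integral>x. (\<Sum>i\<in>Basis. indicator \<Omega> x *\<^sub>R (norm (partial_deriv i (\<psi> k) x))\<^sup>2) \<partial>lebesgue)
       = (\<Sum>i\<in>Basis. LINT x:\<Omega>|lebesgue. (norm (partial_deriv i (\<psi> k) x))\<^sup>2)"
      unfolding set_lebesgue_integral_def by (intro Bochner_Integration.integral_sum int)
    also have "\<dots> \<le> (\<Sum>i\<in>Basis. 2 * (LINT x:\<Omega>|lebesgue. (norm (g i x))\<^sup>2) + 2 * ?B k i)"
      by (intro sum_mono L2_diff(2) gL2 d\<psi>L2)
    also have "\<dots> = 2 * (\<Sum>i\<in>Basis. LINT x:\<Omega>|lebesgue. (norm (g i x))\<^sup>2) + 2 * (\<Sum>i\<in>Basis. ?B k i)"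
      by (simp add: sum.distrib sum_distrib_left)
    also have "\<dots> \<le> G"
    proof -
      have "1 / real (Suc k) \<le> 1" by simp
      then show ?thesis using sum[of k] nonneg[of "\<lambda>x. f x - \<psi> k x"] unfolding G_def by linarith
    qed
    finally show ?thesis by (simp add: ennreal_leI)
  qed
  let ?u = "\<lambda>k x. indicator \<Omega> x *\<^sub>R (norm (f x - \<psi> k x))\<^sup>2"
  have "integrable lebesgue (?u k)" for k
    using L2_diff(1)[OF fL2 \<psi>L2] by (simp add: L2_def set_integrable_def)
  moreover have "(\<lambda>k. \<integral>x. norm (?u k x) \<partial>lebesgue) \<longlonglongrightarrow> 0"
  proof (rule tendsto_sandwich[OF _ _ tendsto_const LIMSEQ_Suc[OF lim_1_over_n]])
    have e: "(\<integral>x. norm (?u k x) \<partial>lebesgue) = ?A k" for k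
      unfolding set_lebesgue_integral_def by (intro Bochner_Integration.integral_cong) (auto simp: indicator_def)
    show "\<forall>\<^sub>F k in sequentially. 0 \<le> (\<integral>x. norm (?u k x) \<partial>lebesgue)" by simp
    show "\<forall>\<^sub>F k in sequentially. (\<integral>x. norm (?u k x) \<partial>lebesgue) \<le> 1 / real (Suc k)"
    proof (rule always_eventually, rule allI)
      fix k
      have "0 \<le> (\<Sum>i\<in>Basis. ?B k i)" by (intro sum_nonneg nonneg)
      then show "(\<integral>x. norm (?u k x) \<partial>lebesgue) \<le> 1 / real (Suc k)" unfolding e using sum[of k] by linarith
    qed
  qed
  \<comment> \<open>Convergence of the squared distance in the mean gives almost everywhere
    convergence only along a subsequence. The gradient bound is uniform in k and passes to
    it.\<close>
  ultimately obtain r where r: "AE x in lebesgue. (\<lambda>k. ?u (r k) x) \<longlonglongrightarrow> 0"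
    using tendsto_L1_AE_subseq[of lebesgue ?u] by blast
  have ae: "AE x in lborel. x \<in> \<Omega> \<longrightarrow> (\<lambda>k. \<psi> (r k) x) \<longlonglongrightarrow> f x"
    using r unfolding AE_completion_iff
  proof eventually_elim
    case (elim x)
    show ?case
    proof
      assume "x \<in> \<Omega>"
      then have "(\<lambda>k. (norm (f x - \<psi> (r k) x))\<^sup>2) \<longlonglongrightarrow> 0" using elim by simp
      then have "(\<lambda>k. sqrt ((norm (f x - \<psi> (r k) x))\<^sup>2)) \<longlonglongrightarrow> sqrt 0" by (rule tendsto_real_sqrt)
      then have "(\<lambda>k. norm (\<psi> (r k) x - f x)) \<longlonglongrightarrow> 0" by (simp add: norm_minus_commute)
      then show "(\<lambda>k. \<psi> (r k) x) \<longlonglongrightarrow> f x" by (simp only: tendsto_norm_zero_iff LIM_zero_iff)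
    qed
  qed
  show ?thesis by (rule that[of "\<lambda>k. \<psi> (r k)" G]; fact)
qed

section \<open>Translation to \<open>P\<close> and a Borel representative\<close>

lemma nn_integral_lborel_plus:
  fixes g :: "'a::euclidean_space \<Rightarrow> ennreal"
  assumes "g \<in> borel_measurable borel"
  shows "(\<integral>\<^sup>+y. g (c + y) \<partial>lborel) = (\<integral>\<^sup>+x. g x \<partial>lborel)"
  by (subst (2) lborel_distr_plus[of c, symmetric], subst nn_integral_distr) (use assms in auto)

lemma AE_lborel_plus:
  fixes Q :: "'a::euclidean_space \<Rightarrow> bool"
  assumes "AE x in lborel. Q x"
  shows "AE y in lborel. Q (c + y)"
proof -
  obtain N where N: "N \<in> null_sets lborel" "{x. \<not> Q x} \<subseteq> N"
    using assms(1) by (auto elim!: AE_E simp: null_sets_def)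
  then have [measurable]: "N \<in> sets borel" by auto
  have "(\<integral>\<^sup>+y. indicator N (c + y) \<partial>(lborel :: 'a measure)) = 0"
    using N(1) by (subst nn_integral_lborel_plus) (auto simp: null_sets_def)
  then have "AE y in lborel. (indicator N (c + y) :: ennreal) = 0"
    by (subst (asm) nn_integral_0_iff_AE) auto
  then show ?thesis
    by eventually_elim (use N(2) in \<open>auto simp: indicator_def split: if_splits\<close>)
qed

text \<open>\<open>g\<close> inherits its measurability from \<open>H\<close>, since Lebesgue
  measure is complete. This matters for integrands that contain
  \<open>kipriyanov P \<alpha> f\<close>, about whose measurability nothing is known in
  advance.\<close>

lemma integral_lebesgue_translate:
  fixes H :: "'a::euclidean_space \<Rightarrow> 'b::euclidean_space"
  assumes [measurable]: "H \<in> borel_measurable borel" and ae: "AE y in lborel. g (P + y) = H y"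
  shows "integral\<^sup>L lebesgue g = integral\<^sup>L lborel H"
proof -
  have "AE x in lborel. g x = H (- P + x)"
    using AE_lborel_plus[OF ae, of "- P"] by simp
  then have ae': "AE x in lebesgue. H (- P + x) = g x"
    by (subst AE_completion_iff) auto
  have m: "(\<lambda>x. H (- P + x)) \<in> borel_measurable lborel" by measurable
  have "integral\<^sup>L lebesgue g = (\<integral>x. H (- P + x) \<partial>lebesgue)"
    using borel_measurable_AE[OF measurable_completion[OF m] ae'] measurable_completion[OF m] ae'
    by (intro integral_cong_AE) auto
  also have "\<dots> = (\<integral>x. H (- P + x) \<partial>lborel)" by (rule integral_completion[OF m])
  also have "\<dots> = integral\<^sup>L lborel H"
    by (subst (2) lborel_distr_plus[of "- P", symmetric], subst integral_distr) auto
  finally show ?thesis .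
qed

text \<open>\<open>F\<close> is \<open>f\<close> moved so that \<open>P\<close> becomes the origin,
  set to 0 off the domain and chosen Borel. Fubini requires F (s x) to be jointly measurable in x
  and s, which composition with a merely Lebesgue measurable function does not ensure.\<close>

lemma H10_radial:
  fixes \<Omega> :: "'a::euclidean_space set"
  assumes n: "2 \<le> DIM('a)" and \<alpha>: "0 < \<alpha>" "\<alpha> < (1::real)" and \<Omega>: "open \<Omega>" "bounded \<Omega>" and P: "P \<notin> \<Omega>"
    and D: "\<And>y. P + y \<in> \<Omega> \<Longrightarrow> norm y \<le> D" and f: "f \<in> H10 \<Omega>"
  obtains F where "F \<in> borel_measurable borel" "\<And>y. P + y \<notin> \<Omega> \<Longrightarrow> F y = 0"
    "AE y in lborel. P + y \<in> \<Omega> \<longrightarrow> F y = f (P + y)"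
    "integrable lborel (\<lambda>y. norm y powr (- \<alpha>) * (norm (F y))\<^sup>2)"
    "(\<integral>\<^sup>+x. \<integral>\<^sup>+s. ennreal (norm x powr (- \<alpha>) * (norm (F x) * norm (F x - F (s *\<^sub>R x))) *
      ((1 - s) powr (- \<alpha> - 1) * s ^ (DIM('a) - 1))) * indicator {0<..<1} s \<partial>lborel \<partial>lborel) < \<infinity>"
proof -
  obtain \<phi> G where \<phi>: "\<And>k::nat. \<phi> k \<in> test_functions \<Omega>" and G: "0 \<le> G"
    and grad: "\<And>k. (\<integral>\<^sup>+x. ennreal (\<Sum>i\<in>Basis. (norm (partial_deriv i (\<phi> k) x))\<^sup>2) \<partial>lborel) \<le> ennreal G"
    and lim: "AE x in lborel. x \<in> \<Omega> \<longrightarrow> (\<lambda>k. \<phi> k x) \<longlonglongrightarrow> f x"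
    by (rule H10_approximation[OF \<Omega> f]) blast
  note t = test_functionsD[OF \<phi>]
  have [measurable]: "\<Omega> \<in> sets borel" using \<Omega> by simp
  have [measurable]: "\<phi> k \<in> borel_measurable borel" for k
    by (rule borel_measurable_continuous_onI[OF t(2)])
  define u where "u k y = \<phi> k (P + y)" for k y
  define v where "v k y = (\<Sum>i\<in>Basis. (norm (partial_deriv i (\<phi> k) (P + y)))\<^sup>2)" for k y
  \<comment> \<open>Where the test functions do not converge, \<open>lim\<close> returns an
    arbitrary value; inside the domain that concerns only a null set, and \<open>F\<close> is Borel
    in any case.\<close>
  define F where "F y = indicator \<Omega> (P + y) *\<^sub>R lim (\<lambda>k. \<phi> k (P + y))" for y
  have F[measurable]: "F \<in> borel_measurable borel" unfolding F_def[abs_def] by measurable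
  have FS: "F y = 0" if "P + y \<notin> \<Omega>" for y using that by (simp add: F_def)
  have ae: "AE y in lborel. P + y \<in> \<Omega> \<longrightarrow> F y = f (P + y)"
    using AE_lborel_plus[OF lim, of P] by eventually_elim (auto simp: F_def limI)
  have uF: "AE y in lborel. (\<lambda>k. u k y) \<longlonglongrightarrow> F y"
    using AE_lborel_plus[OF lim, of P]
  proof eventually_elim
    case (elim y)
    then show ?case by (cases "P + y \<in> \<Omega>") (auto simp: F_def u_def limI t(4))
  qed
  have ucont: "continuous_on UNIV (u k)" for k
    unfolding u_def[abs_def] by (rule continuous_on_compose2[OF t(2)]) (auto intro!: continuous_intros)
  have vcont: "continuous_on UNIV (v k)" for k
    unfolding v_def[abs_def]
    by (intro continuous_intros continuous_on_compose2[OF t(3)]) auto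
  have vnn: "0 \<le> v k y" for k y by (auto simp: v_def intro: sum_nonneg)
  have uD: "u k y = 0" if "D < norm y" for k y
    using D[of y] that t(4)[of "P + y" k] by (force simp: u_def)
  have vD: "v k y = 0" if "D < norm y" for k y
    using D[of y] that t(5)[of "P + y" _ k] by (force simp: v_def)
  have seg: "ennreal ((norm (u k x - u k (s *\<^sub>R x)))\<^sup>2)
        \<le> ennreal ((1 - s) * (norm x)\<^sup>2) * (\<integral>\<^sup>+\<tau>\<in>{s..1}. ennreal (v k (\<tau> *\<^sub>R x)) \<partial>lborel)"
    if "0 < s" "s < 1" for k x s
    unfolding u_def v_def by (rule segment_difference_bound[OF t(1) t(3) that])
  have vG: "(\<integral>\<^sup>+y. ennreal (v k y) \<partial>lborel) \<le> ennreal G" for k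
  proof -
    have "(\<integral>\<^sup>+y. ennreal (v k y) \<partial>lborel) = (\<integral>\<^sup>+x. ennreal (\<Sum>i\<in>Basis. (norm (partial_deriv i (\<phi> k) x))\<^sup>2) \<partial>lborel)"
      unfolding v_def
      by (rule nn_integral_lborel_plus) (use borel_measurable_continuous_onI[OF t(3)] in measurable)
    then show ?thesis using grad by simp
  qed
  have [measurable]: "u k \<in> borel_measurable borel" for k
    using borel_measurable_continuous_onI[OF ucont] .
  define K where "K = 2 * (2 powr (real DIM('a) - \<alpha>) * D powr (2 - \<alpha>) * G) / (2 powr (real DIM('a) - \<alpha>) - 2)"
  have "(\<integral>\<^sup>+y. ennreal (norm y powr (- \<alpha>) * (norm (F y))\<^sup>2) \<partial>lborel) \<le> ennreal K"
  proof (rule nn_integral_le_AE_limit)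
    show "AE y in lborel. (\<lambda>k. ennreal (norm y powr (- \<alpha>) * (norm (u k y))\<^sup>2)) \<longlonglongrightarrow> ennreal (norm y powr (- \<alpha>) * (norm (F y))\<^sup>2)"
      using uF by eventually_elim (intro tendsto_intros)
    show "(\<integral>\<^sup>+y. ennreal (norm y powr (- \<alpha>) * (norm (u k y))\<^sup>2) \<partial>lborel) \<le> ennreal K" for k
    proof -
      obtain \<delta> where "0 < \<delta>" "\<And>y. norm y < \<delta> \<Longrightarrow> u k y = 0"
        using t(6)[OF P, of k] by (auto simp: u_def)
      then show ?thesis
        unfolding K_def
        by (intro nn_integral_Hardy_le[OF n ucont vcont vnn \<alpha> vD uD _ _ seg vG G]) auto
    qed
  qed measurable
  then have N: "(\<integral>\<^sup>+y. ennreal (norm y powr (- \<alpha>) * (norm (F y))\<^sup>2) \<partial>lborel) < \<infinity>"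
    by (rule le_less_trans) simp
  have int: "integrable lborel (\<lambda>y. norm y powr (- \<alpha>) * (norm (F y))\<^sup>2)"
    using N by (intro integrableI_nonneg) auto
  have E: "(\<integral>\<^sup>+x. ennreal (norm x powr (- \<alpha>) * (norm (F x - F (s *\<^sub>R x)))\<^sup>2) \<partial>lborel)
      \<le> ennreal ((1 - s)\<^sup>2 * s powr (\<alpha> - real DIM('a) - 2) * (D powr (2 - \<alpha>) * G))"
    if s: "0 < s" "s < 1" for s
  proof (rule nn_integral_le_AE_limit)
    show "AE y in lborel. (\<lambda>k. ennreal (norm y powr (- \<alpha>) * (norm (u k y - u k (s *\<^sub>R y)))\<^sup>2))
       \<longlonglongrightarrow> ennreal (norm y powr (- \<alpha>) * (norm (F y - F (s *\<^sub>R y)))\<^sup>2)"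
      \<comment> \<open>The limit is needed at y and at s y at once, so the exceptional null set has
        to be dilated as well.\<close>
      using uF AE_lborel_scaleR[OF uF s(1)] by eventually_elim (intro tendsto_intros)
    show "(\<integral>\<^sup>+y. ennreal (norm y powr (- \<alpha>) * (norm (u k y - u k (s *\<^sub>R y)))\<^sup>2) \<partial>lborel)
       \<le> ennreal ((1 - s)\<^sup>2 * s powr (\<alpha> - real DIM('a) - 2) * (D powr (2 - \<alpha>) * G))" for k
    proof -
      have "(\<integral>\<^sup>+y. ennreal (norm y powr (- \<alpha>) * (norm (u k y - u k (s *\<^sub>R y)))\<^sup>2) \<partial>lborel)
        \<le> ennreal ((1 - s)\<^sup>2 * s powr (\<alpha> - real DIM('a) - 2) * D powr (2 - \<alpha>)) * (\<integral>\<^sup>+y. ennreal (v k y) \<partial>lborel)"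
        by (rule nn_integral_dilation_difference[OF ucont vcont vnn s \<alpha> vD seg[OF s]])
      also have "\<dots> \<le> ennreal ((1 - s)\<^sup>2 * s powr (\<alpha> - real DIM('a) - 2) * D powr (2 - \<alpha>)) * ennreal G"
        by (intro mult_left_mono vG) simp
      also have "\<dots> = ennreal ((1 - s)\<^sup>2 * s powr (\<alpha> - real DIM('a) - 2) * (D powr (2 - \<alpha>) * G))"
        by (subst ennreal_mult'[symmetric]) (simp_all add: mult.assoc)
      finally show ?thesis .
    qed
  qed measurable
  have "0 \<le> D powr (2 - \<alpha>) * G" using G by simp
  from that[OF F FS ae int nn_integral_kernel_finite[OF n F \<alpha> N this E]] show ?thesis .
qed

section \<open>The operator along rays\<close>

text \<open>The operator samples \<open>f\<close> along a single ray, which is a null set, so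
  passing to the representative \<open>F\<close> might alter it. For almost every y it does not:
  every dilate of the exceptional set is null, hence by Fubini almost every ray meets that set only
  in a null set of parameters.\<close>

lemma kipriyanov_AE:
  fixes \<Omega> :: "'a::euclidean_space set"
  assumes \<Omega>: "open \<Omega>" "convex \<Omega>" and P: "P \<in> frontier \<Omega>" and F[measurable]: "F \<in> borel_measurable borel"
    and ae: "AE y in lborel. P + y \<in> \<Omega> \<longrightarrow> F y = f (P + y)"
  shows "AE y in lborel. P + y \<in> \<Omega> \<longrightarrow> kipriyanov P \<alpha> f (P + y) =
    of_real (norm y powr (- \<alpha>)) *
      (of_real (\<alpha> / Gamma (1 - \<alpha>)) * (\<integral>s. (F y - F (s *\<^sub>R y)) *
          of_real ((1 - s) powr (- \<alpha> - 1) * s ^ (DIM('a) - 1) * indicator {0<..<1} s) \<partial>lborel)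
        + of_real (kipriyanov_const DIM('a) \<alpha>) * F y)"
proof -
  have P': "P \<notin> \<Omega>" "P \<in> closure \<Omega>"
    using P \<Omega> by (auto simp: frontier_def interior_open)
  \<comment> \<open>The open segment from a point of the closure to an interior point of a convex
    set lies in the interior. So the ray stays in the domain all the way up to y.\<close>
  have ray: "P + s *\<^sub>R y \<in> \<Omega>" if "P + y \<in> \<Omega>" "0 < s" "s < 1" for s :: real and y
  proof -
    have "P + s *\<^sub>R y = (1 - s) *\<^sub>R P + s *\<^sub>R (P + y)" by (simp add: algebra_simps)
    moreover have "P \<noteq> P + y" using P' that(1) by metis
    ultimately have "P + s *\<^sub>R y \<in> open_segment P (P + y)"
      using that by (auto simp: in_segment)
    then show ?thesis
      using in_interior_closure_convex_segment[OF \<Omega>(2), of "P + y" P] that(1) P' \<Omega>(1)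
      by (auto simp: interior_open open_segment_commute)
  qed
  obtain N where N: "N \<in> null_sets lborel" and Nf: "\<And>y. y \<notin> N \<Longrightarrow> P + y \<in> \<Omega> \<Longrightarrow> F y = f (P + y)"
    using ae by (auto elim!: AE_E simp: null_sets_def) blast
  have [measurable]: "N \<in> sets borel" using N by auto
  have "AE s in lborel. AE y in lborel. (0::real) < s \<longrightarrow> s *\<^sub>R y \<notin> N"
  proof (rule AE_I2)
    fix s :: real
    show "AE y in lborel. 0 < s \<longrightarrow> s *\<^sub>R y \<notin> N"
      using AE_lborel_scaleR[OF AE_not_in[OF N], of s] by (cases "0 < s") auto
  qed
  \<comment> \<open>The exchange of quantifiers: from almost all y for each s to almost all s for
    almost every y.\<close>
  then have "AE y in lborel. AE s in lborel. (0::real) < s \<longrightarrow> s *\<^sub>R y \<notin> N"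
    by (subst lborel_pair.AE_commute) measurable
  with AE_not_in[OF N] show ?thesis
  proof eventually_elim
    case (elim y)
    show ?case
    proof
      assume y: "P + y \<in> \<Omega>"
      define r where "r = norm y"
      have r: "0 < r" using P' y by (auto simp: r_def)
      define e where "e = y /\<^sub>R r"
      have re: "r *\<^sub>R e = y" using r by (simp add: e_def)
      have Fy: "f (P + y) = F y" using Nf elim(1) y by metis
      define \<Psi> where "\<Psi> t = indicator {0..r} t *\<^sub>R ((F y - F (t *\<^sub>R e)) / of_real ((r - t) powr (\<alpha> + 1)) * of_real ((t / r) ^ (DIM('a) - 1)))" for t
      have ofr[measurable]: "(of_real :: real \<Rightarrow> complex) \<in> borel_measurable borel"
        by (intro borel_measurable_continuous_onI continuous_intros)
      have \<Psi>[measurable]: "\<Psi> \<in> borel_measurable borel" unfolding \<Psi>_def[abs_def] by measurable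
      have "AE t in lborel. (1 / r) *\<^sub>R t = 0 \<or> (0 < (1 / r) *\<^sub>R t \<longrightarrow> ((1 / r) *\<^sub>R t) *\<^sub>R y \<notin> N)"
        using AE_lborel_scaleR[OF elim(2), of "1 / r"] r by auto
      then have aet: "AE t in lborel. indicator {0..r} t *\<^sub>R ((f (P + y) - f (P + t *\<^sub>R e)) / of_real ((r - t) powr (\<alpha> + 1)) * of_real ((t / r) ^ (DIM('a) - 1))) = \<Psi> t"
        using AE_lborel_singleton[of 0] AE_lborel_singleton[of r]
      proof eventually_elim
        case (elim t)
        show ?case
        proof (cases "t \<in> {0..r}")
          case True
          then have t: "0 < t" "t < r" using elim by auto
          have te: "(t / r) *\<^sub>R y = t *\<^sub>R e" using r by (simp add: e_def divide_inverse)
          have "P + t *\<^sub>R e \<in> \<Omega>" using ray[OF y, of "t / r"] t r te by simp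
          moreover have "t *\<^sub>R e \<notin> N" using elim(1) t r te by auto
          ultimately have "f (P + t *\<^sub>R e) = F (t *\<^sub>R e)" using Nf by metis
          then show ?thesis by (simp add: \<Psi>_def Fy)
        qed (simp add: \<Psi>_def)
      qed
      have "(LINT t:{0..r}|lebesgue. (f (P + y) - f (P + t *\<^sub>R e)) / of_real ((r - t) powr (\<alpha> + 1)) * of_real ((t / r) ^ (DIM('a) - 1)))
        = integral\<^sup>L lborel \<Psi>"
        unfolding set_lebesgue_integral_def
        by (rule integral_lebesgue_translate[where P = 0, OF \<Psi>]) (use aet in simp)
      \<comment> \<open>The substitution t = r s: the Jacobian r and (r-t)^(-\<alpha>-1) combine to
        r^(-\<alpha>) (1-s)^(-\<alpha>-1). A divergent Bochner integral has the value 0, and every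
        step here respects that convention, so the identity holds at such y too.\<close>
      also have "\<dots> = \<bar>r\<bar> *\<^sub>R (\<integral>s. \<Psi> (0 + r * s) \<partial>lborel)"
        using r by (intro lborel_integral_real_affine) auto
      also have "\<dots> = (\<integral>s. r *\<^sub>R \<Psi> (r * s) \<partial>lborel)"
        using r by simp
      also have "\<dots> = (\<integral>s. of_real (r powr (- \<alpha>)) * ((F y - F (s *\<^sub>R y)) *
          of_real ((1 - s) powr (- \<alpha> - 1) * s ^ (DIM('a) - 1) * indicator {0<..<1} s)) \<partial>lborel)"
      proof (rule integral_cong_AE)
        show "AE s in lborel. r *\<^sub>R \<Psi> (r * s) = of_real (r powr (- \<alpha>)) * ((F y - F (s *\<^sub>R y)) *
          of_real ((1 - s) powr (- \<alpha> - 1) * s ^ (DIM('a) - 1) * indicator {0<..<1} s))"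
          using AE_lborel_singleton[of 0] AE_lborel_singleton[of 1]
        proof eventually_elim
          case (elim s)
          show ?case
          proof (cases "0 < s \<and> s < 1")
            case True
            then have s: "0 < s" "s < 1" by auto
            have a1: "(r * s) *\<^sub>R e = s *\<^sub>R y" using re by (metis mult.commute scaleR_scaleR)
            have a2: "indicator {0..r} (r * s) = (1::real)" using s r by auto
            have a3: "r * s / r = s" using r by simp
            have p: "r / (r - r * s) powr (\<alpha> + 1) = r powr (- \<alpha>) * (1 - s) powr (- \<alpha> - 1)"
            proof -
              have "(r - r * s) powr (\<alpha> + 1) = r powr (\<alpha> + 1) * (1 - s) powr (\<alpha> + 1)"
                using r s by (simp add: powr_mult[symmetric] algebra_simps)
              moreover have "r / r powr (\<alpha> + 1) = r powr (- \<alpha>)"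
                using r by (simp add: powr_add powr_minus_divide)
              moreover have "1 / (1 - s) powr (\<alpha> + 1) = (1 - s) powr (- \<alpha> - 1)"
                by (simp add: powr_minus_divide[symmetric])
              ultimately show ?thesis
                by (metis (no_types, opaque_lifting) divide_divide_eq_left mult.right_neutral times_divide_eq_right)
            qed
            have "r *\<^sub>R \<Psi> (r * s) = (F y - F (s *\<^sub>R y)) * of_real (r / (r - r * s) powr (\<alpha> + 1)) * of_real (s ^ (DIM('a) - 1))"
              unfolding \<Psi>_def a1 a2 a3 by (simp add: scaleR_conv_of_real)
            then show ?thesis unfolding p using s by (simp add: mult_ac)
          qed (use elim r in \<open>auto simp: \<Psi>_def indicator_def mult_le_cancel_left1 zero_le_mult_iff\<close>)
        qed
      qed measurable
      also have "\<dots> = of_real (r powr (- \<alpha>)) * (\<integral>s. (F y - F (s *\<^sub>R y)) *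
          of_real ((1 - s) powr (- \<alpha> - 1) * s ^ (DIM('a) - 1) * indicator {0<..<1} s) \<partial>lborel)"
        by (rule integral_mult_right_zero)
      finally have I: "(LINT t:{0..r}|lebesgue. (f (P + y) - f (P + t *\<^sub>R e)) / of_real ((r - t) powr (\<alpha> + 1)) * of_real ((t / r) ^ (DIM('a) - 1)))
        = \<dots>" .
      have "dist P (P + y) = r" by (simp add: dist_norm r_def)
      then have k: "kipriyanov P \<alpha> f (P + y) = of_real (\<alpha> / Gamma (1 - \<alpha>)) *
          (LINT t:{0..r}|lebesgue. (f (P + y) - f (P + t *\<^sub>R e)) / of_real ((r - t) powr (\<alpha> + 1)) * of_real ((t / r) ^ (DIM('a) - 1)))
        + of_real (kipriyanov_const DIM('a) \<alpha>) * f (P + y) * of_real (r powr (- \<alpha>))"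
        unfolding kipriyanov_def Let_def by (simp add: e_def)
      then show "kipriyanov P \<alpha> f (P + y) = of_real (norm y powr (- \<alpha>)) *
        (of_real (\<alpha> / Gamma (1 - \<alpha>)) * (\<integral>s. (F y - F (s *\<^sub>R y)) *
          of_real ((1 - s) powr (- \<alpha> - 1) * s ^ (DIM('a) - 1) * indicator {0<..<1} s) \<partial>lborel)
        + of_real (kipriyanov_const DIM('a) \<alpha>) * F y)"
        using k[unfolded I, unfolded Fy] unfolding r_def[symmetric] by (simp only: distrib_left mult_ac)
    qed
  qed
qed

lemma holder_with_continuous_on:
  assumes h: "holder_with S \<beta> M \<rho>" and \<beta>: "0 < \<beta>"
  shows "continuous_on S \<rho>"
proof (unfold continuous_on_def, rule ballI)
  fix x assume x: "x \<in> S"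
  have "((\<lambda>y. M * dist y x powr \<beta>) \<longlongrightarrow> M * dist x x powr \<beta>) (at x within S)"
    using \<beta> by (intro tendsto_intros tendsto_powr') auto
  then have "((\<lambda>y. M * dist y x powr \<beta>) \<longlongrightarrow> 0) (at x within S)" by simp
  moreover have "\<forall>\<^sub>F y in at x within S. norm (\<rho> y - \<rho> x) \<le> M * dist y x powr \<beta>"
    using h x by (auto simp: eventually_at_filter holder_with_def)
  ultimately have "((\<lambda>y. \<rho> y - \<rho> x) \<longlongrightarrow> 0) (at x within S)"
    by (rule Lim_null_comparison[rotated])
  then show "(\<rho> \<longlongrightarrow> \<rho> x) (at x within S)" by (simp only: LIM_zero_iff)
qed

section \<open>Assembling the estimate\<close>

text \<open>A common form of both claims: \<open>M\<close> is the Hoelder constant and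
  \<open>m\<close> the infimum of \<rho>, or \<open>M = 0\<close> and \<open>m\<close> is a
  placeholder in a vanishing term. \<open>N\<close> and \<open>N1\<close> are the squared norms with
  and without the factor |y|^(-\<alpha>), both weighted by \<rho>, and \<open>N0\<close> is the
  plain one.\<close>

lemma Re_weighted_inner_kipriyanov_ge:
  fixes \<Omega> :: "'a::euclidean_space set"
  assumes n: "2 \<le> DIM('a)" and \<alpha>: "0 < \<alpha>" "\<alpha> < (1::real)"
    and \<Omega>: "open \<Omega>" "convex \<Omega>" "bounded \<Omega>" "\<Omega> \<noteq> {}" and P: "P \<in> frontier \<Omega>"
    and \<beta>: "\<alpha> < \<beta>" and \<rho>_nn: "\<And>Q. Q \<in> closure \<Omega> \<Longrightarrow> 0 \<le> \<rho> Q"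
    and \<rho>_cont: "continuous_on (closure \<Omega>) \<rho>"
    and M: "0 \<le> M" and m: "0 < m" and Mm: "M = 0 \<or> (\<forall>Q\<in>\<Omega>. m \<le> \<rho> Q)"
    and dil: "\<And>y s. P + y \<in> \<Omega> \<Longrightarrow> 0 < s \<Longrightarrow> s < 1 \<Longrightarrow> P + y /\<^sub>R s \<in> \<Omega> \<Longrightarrow>
        \<rho> (P + y /\<^sub>R s) \<le> \<rho> (P + y) + M * (norm y * (1 - s) / s) powr \<beta>"
    and f: "f \<in> H10 \<Omega>"
  shows "(1 / 2 * diameter \<Omega> powr (- \<alpha>) * (1 / Gamma (1 - \<alpha>) + kipriyanov_const DIM('a) \<alpha>)
            - \<alpha> * M * diameter \<Omega> powr (\<beta> - \<alpha>) / (2 * Gamma (1 - \<alpha>) * (\<beta> - \<alpha>) * m))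
           * (weighted_norm \<Omega> \<rho> f)\<^sup>2
     \<le> Re (weighted_inner \<Omega> \<rho> f (kipriyanov P \<alpha> f))"
proof -
  define D where "D = diameter \<Omega>"
  define S where "S = {y. P + y \<in> \<Omega>}"
  have P': "P \<notin> \<Omega>" "P \<in> closure \<Omega>"
    using P \<Omega>(1) by (auto simp: frontier_def interior_open)
  have SD: "norm y \<le> D" if "P + y \<in> \<Omega>" for y
  proof -
    \<comment> \<open>\<open>P\<close> is only a boundary point, so the bound goes through the
      closure, which has the same diameter.\<close>
    have "dist P (P + y) \<le> diameter (closure \<Omega>)"
      using that P' closure_subset[of \<Omega>] \<Omega>(3) by (intro diameter_bounded_bound) auto
    then show ?thesis using \<Omega>(3) by (simp add: D_def diameter_closure dist_norm)
  qed
  have SD': "norm y \<le> D" if "y \<in> S" for y using SD that by (simp add: S_def)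
  have S0: "0 \<notin> S" using P' by (simp add: S_def)
  obtain Q where "Q \<in> \<Omega>" using \<Omega>(4) by auto
  then have "P + (Q - P) \<in> \<Omega>" "Q - P \<noteq> 0" using P' by auto
  then have D: "0 < D" using SD[of "Q - P"] by (meson less_le_trans zero_less_norm_iff)
  have ofr[measurable]: "(of_real :: real \<Rightarrow> complex) \<in> borel_measurable borel" "cnj \<in> borel_measurable borel"
    by (intro borel_measurable_continuous_onI continuous_intros)+
  obtain F where F[measurable]: "F \<in> borel_measurable borel" and FS: "\<And>y. P + y \<notin> \<Omega> \<Longrightarrow> F y = 0"
    and ae: "AE y in lborel. P + y \<in> \<Omega> \<longrightarrow> F y = f (P + y)"
    and int: "integrable lborel (\<lambda>y. norm y powr (- \<alpha>) * (norm (F y))\<^sup>2)"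
    and J: "(\<integral>\<^sup>+x. \<integral>\<^sup>+s. ennreal (norm x powr (- \<alpha>) * (norm (F x) * norm (F x - F (s *\<^sub>R x))) *
      ((1 - s) powr (- \<alpha> - 1) * s ^ (DIM('a) - 1))) * indicator {0<..<1} s \<partial>lborel \<partial>lborel) < \<infinity>"
    by (rule H10_radial[OF n \<alpha> \<Omega>(1,3) P'(1) SD f]) blast+
  have FS': "F y = 0" if "y \<notin> S" for y using FS that by (simp add: S_def)
  \<comment> \<open>Continuity of \<rho> is known only on the closure. Cutting it off outside the
    open domain gives a Borel function on the whole space.\<close>
  define \<rho>0 where "\<rho>0 y = indicator \<Omega> (P + y) *\<^sub>R \<rho> (P + y)" for y
  have "(\<lambda>x. indicator \<Omega> x *\<^sub>R \<rho> x) \<in> borel_measurable borel"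
    using \<Omega>(1) by (intro borel_measurable_continuous_on_indicator continuous_on_subset[OF \<rho>_cont closure_subset]) auto
  then have \<rho>0[measurable]: "\<rho>0 \<in> borel_measurable borel" unfolding \<rho>0_def[abs_def] by measurable
  have \<rho>0_nn: "0 \<le> \<rho>0 y" for y
    using \<rho>_nn closure_subset[of \<Omega>] by (auto simp: \<rho>0_def indicator_def)
  have "bounded (\<rho> ` closure \<Omega>)"
    using \<Omega>(3) by (intro compact_imp_bounded compact_continuous_image \<rho>_cont) auto
  then obtain R0 where "\<And>x. x \<in> closure \<Omega> \<Longrightarrow> \<bar>\<rho> x\<bar> \<le> R0"
    unfolding bounded_iff by auto
  then have R: "\<rho>0 y \<le> \<bar>R0\<bar>" for y
    using closure_subset[of \<Omega>] by (force simp: \<rho>0_def indicator_def)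
  have \<rho>0S: "\<rho>0 y = 0" if "y \<notin> S" for y using that by (simp add: \<rho>0_def S_def)
  have dil0: "\<rho>0 (y /\<^sub>R s) \<le> \<rho>0 y + M * (norm y * (1 - s) / s) powr \<beta>"
    if "y \<in> S" "0 < s" "s < 1" "y /\<^sub>R s \<in> S" for y s
    using dil[of y s] that by (simp add: S_def \<rho>0_def)
  define \<Phi> where "\<Phi> x s = F x * cnj (F x - F (s *\<^sub>R x)) *
      of_real (norm x powr (- \<alpha>) * \<rho>0 x * ((1 - s) powr (- \<alpha> - 1) * s ^ (DIM('a) - 1)) * indicator {0<..<1} s)" for x s
  define N where "N = (\<integral>x. norm x powr (- \<alpha>) * (norm (F x))\<^sup>2 * \<rho>0 x \<partial>lborel)"
  define N1 where "N1 = (\<integral>x. (norm (F x))\<^sup>2 * \<rho>0 x \<partial>lborel)"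
  define N0 where "N0 = (\<integral>x. (norm (F x))\<^sup>2 \<partial>lborel)"
  define c where "c = \<alpha> / Gamma (1 - \<alpha>)"
  define C where "C = kipriyanov_const DIM('a) \<alpha>"
  have G: "0 < Gamma (1 - \<alpha>)" "0 < Gamma (real DIM('a) - \<alpha>)"
    using \<alpha> n by (auto intro!: Gamma_real_pos)
  have G0: "Gamma (1 - \<alpha>) \<noteq> 0" "Gamma (real DIM('a) - \<alpha>) \<noteq> 0"
    using G by linarith+
  have c: "0 < c" using \<alpha> G by (simp add: c_def)
  have C: "0 \<le> C" using G by (simp add: C_def kipriyanov_const_def)
  have \<Phi>_int: "integrable (lborel \<Otimes>\<^sub>M lborel) (case_prod \<Phi>)"
    unfolding \<Phi>_def
    by (rule kernel_form_lower_bound(1)[where S = S and R = "\<bar>R0\<bar>" and M = M and D = D and \<beta> = \<beta>]; fact)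

  have low: "- (fact (DIM('a) - 1) * Gamma (1 - \<alpha>) / (\<alpha> * Gamma (real DIM('a) - \<alpha>))) / 2 * N
        + D powr (- \<alpha>) / (2 * \<alpha>) * N1 - M * D powr (\<beta> - \<alpha>) / (2 * (\<beta> - \<alpha>)) * N0
      \<le> Re (\<integral>x. \<integral>s. \<Phi> x s \<partial>lborel \<partial>lborel)"
    unfolding \<Phi>_def N_def N1_def N0_def
    by (rule kernel_form_lower_bound(2)[where S = S and R = "\<bar>R0\<bar>"]; fact)

  \<comment> \<open>The deficit of the kernel form, scaled by \<open>c\<close>, is the zero-order
    coefficient \<open>C\<close>. The form loses \<open>C * N / 2\<close> and the zero-order term
    contributes \<open>C * N\<close>; the surviving half is turned into a multiple of
    \<open>N1\<close> by \<open>N1N\<close>.\<close>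
  have Bc: "c * (fact (DIM('a) - 1) * Gamma (1 - \<alpha>) / (\<alpha> * Gamma (real DIM('a) - \<alpha>))) = C"
    using \<alpha> G0 by (simp add: c_def C_def kipriyanov_const_def)
  have pw: "D powr (- \<alpha>) * (norm (F y))\<^sup>2 \<le> norm y powr (- \<alpha>) * (norm (F y))\<^sup>2" for y
  proof (cases "P + y \<in> \<Omega>")
    case True
    then have "0 < norm y" using P' by auto
    then show ?thesis using SD[OF True] \<alpha> by (intro mult_right_mono powr_mono2') auto
  qed (simp add: FS)
  have int0: "integrable lborel (\<lambda>y. (norm (F y))\<^sup>2)"
  proof -
    have "integrable lborel (\<lambda>y. D powr (- \<alpha>) * (norm (F y))\<^sup>2)"
      by (rule Bochner_Integration.integrable_bound[OF int]) (use pw in auto)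
    then show ?thesis using D by simp
  qed
  have intw: "integrable lborel (\<lambda>x. norm x powr (- \<alpha>) * (norm (F x))\<^sup>2 * \<rho>0 x)"
    by (rule Bochner_Integration.integrable_bound[OF integrable_mult_right[OF int, of "\<bar>R0\<bar>"]])
       (use \<rho>0_nn R in \<open>auto simp: abs_mult mult.commute[of _ "\<rho>0 _"] intro!: AE_I2 mult_right_mono\<close>)
  have int1: "integrable lborel (\<lambda>x. (norm (F x))\<^sup>2 * \<rho>0 x)"
    by (rule Bochner_Integration.integrable_bound[OF integrable_mult_right[OF int0, of "\<bar>R0\<bar>"]])
       (use \<rho>0_nn R in \<open>auto simp: abs_mult mult.commute[of _ "\<rho>0 _"] intro!: AE_I2 mult_right_mono\<close>)
  have N1N: "D powr (- \<alpha>) * N1 \<le> N"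
  proof -
    have "D powr (- \<alpha>) * N1 = (\<integral>x. D powr (- \<alpha>) * ((norm (F x))\<^sup>2 * \<rho>0 x) \<partial>lborel)"
      by (simp add: N1_def)
    also have "\<dots> \<le> N"
      unfolding N_def
    proof (rule integral_mono[OF integrable_mult_right[OF int1] intw])
      fix x show "D powr (- \<alpha>) * ((norm (F x))\<^sup>2 * \<rho>0 x) \<le> norm x powr (- \<alpha>) * (norm (F x))\<^sup>2 * \<rho>0 x"
        using mult_right_mono[OF pw[of x] \<rho>0_nn[of x]] by (simp add: mult.assoc)
    qed
    finally show ?thesis .
  qed
  have N1_nn: "0 \<le> N1" unfolding N1_def using \<rho>0_nn by (intro integral_nonneg_AE AE_I2) auto
  \<comment> \<open>The Hoelder error is unweighted. Restoring the weight by m \<le> \<rho> puts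
    \<open>m\<close> into the denominator of the correction term.\<close>
  have N0N1: "M * N0 \<le> M / m * N1"
  proof (cases "M = 0")
    case False
    then have mle: "m \<le> \<rho> Q" if "Q \<in> \<Omega>" for Q using Mm that by auto
    have "m * N0 = (\<integral>x. m * (norm (F x))\<^sup>2 \<partial>lborel)" by (simp add: N0_def)
    also have "\<dots> \<le> N1"
      unfolding N1_def
    proof (rule integral_mono[OF integrable_mult_right[OF int0] int1])
      fix x show "m * (norm (F x))\<^sup>2 \<le> (norm (F x))\<^sup>2 * \<rho>0 x"
        using mle[of "P + x"] FS[of x] by (cases "P + x \<in> \<Omega>") (auto simp: \<rho>0_def mult.commute[of m] intro!: mult_left_mono)
    qed
    finally have "N0 \<le> N1 / m" using m by (simp add: field_simps)
    then have "M * N0 \<le> M * (N1 / m)" using M by (rule mult_left_mono)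
    then show ?thesis by simp
  qed simp
  have sq: "z * cnj z = (complex_of_real (cmod z))\<^sup>2" for z
    using complex_norm_square[of z] by simp
  have wn: "(weighted_norm \<Omega> \<rho> f)\<^sup>2 = N1"
  proof -
    have "weighted_inner \<Omega> \<rho> f f = (\<integral>x. of_real ((norm (F x))\<^sup>2 * \<rho>0 x) \<partial>lborel)"
      unfolding weighted_inner_def set_lebesgue_integral_def
    proof (rule integral_lebesgue_translate)
      show "AE y in lborel. indicator \<Omega> (P + y) *\<^sub>R (f (P + y) * cnj (f (P + y)) * of_real (\<rho> (P + y)))
         = complex_of_real ((norm (F y))\<^sup>2 * \<rho>0 y)"
        using ae by eventually_elim (auto simp: \<rho>0_def indicator_def sq)
    qed measurable
    also have "\<dots> = of_real N1" unfolding N1_def by (rule integral_complex_of_real)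
    finally show ?thesis using N1_nn by (simp add: weighted_norm_def)
  qed
  have wi: "weighted_inner \<Omega> \<rho> f (kipriyanov P \<alpha> f) = of_real c * (\<integral>x. \<integral>s. \<Phi> x s \<partial>lborel \<partial>lborel) + of_real (C * N)"
  proof -
    have [measurable]: "case_prod \<Phi> \<in> borel_measurable (lborel \<Otimes>\<^sub>M lborel)"
      using \<Phi>_int by auto
    have "weighted_inner \<Omega> \<rho> f (kipriyanov P \<alpha> f) =
       (\<integral>x. of_real c * (\<integral>s. \<Phi> x s \<partial>lborel) + of_real (C * (norm x powr (- \<alpha>) * (norm (F x))\<^sup>2 * \<rho>0 x)) \<partial>lborel)"
      unfolding weighted_inner_def set_lebesgue_integral_def
    proof (rule integral_lebesgue_translate)
      show "AE y in lborel. indicator \<Omega> (P + y) *\<^sub>R (f (P + y) * cnj (kipriyanov P \<alpha> f (P + y)) * of_real (\<rho> (P + y)))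
         = of_real c * (\<integral>s. \<Phi> y s \<partial>lborel) + of_real (C * (norm y powr (- \<alpha>) * (norm (F y))\<^sup>2 * \<rho>0 y))"
        using ae kipriyanov_AE[OF \<Omega>(1,2) P F ae, of \<alpha>]
      proof eventually_elim
        case (elim y)
        show ?case
        proof (cases "P + y \<in> \<Omega>")
          case True
          define I where "I = (\<integral>s. (F y - F (s *\<^sub>R y)) *
              of_real ((1 - s) powr (- \<alpha> - 1) * s ^ (DIM('a) - 1) * indicator {0<..<1} s) \<partial>lborel)"
          have k: "kipriyanov P \<alpha> f (P + y) = of_real (norm y powr (- \<alpha>)) * (of_real c * I + of_real C * F y)"
            using elim(2) True by (simp only: I_def c_def C_def)
          have "(\<integral>s. \<Phi> y s \<partial>lborel) = (\<integral>s. (F y * of_real (norm y powr (- \<alpha>) * \<rho>0 y)) * cnj ((F y - F (s *\<^sub>R y)) *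
              of_real ((1 - s) powr (- \<alpha> - 1) * s ^ (DIM('a) - 1) * indicator {0<..<1} s)) \<partial>lborel)"
            unfolding \<Phi>_def by (intro Bochner_Integration.integral_cong) (simp_all add: mult_ac)
          also have "\<dots> = (F y * of_real (norm y powr (- \<alpha>) * \<rho>0 y)) * cnj I"
            unfolding I_def by (simp only: integral_mult_right_zero Bochner_Integration.integral_cnj)
          finally have i: "(\<integral>s. \<Phi> y s \<partial>lborel) = (F y * of_real (norm y powr (- \<alpha>) * \<rho>0 y)) * cnj I" .
          have fy: "f (P + y) = F y" and \<rho>y: "\<rho>0 y = \<rho> (P + y)" using elim(1) True by (auto simp: \<rho>0_def)
          show ?thesis
            unfolding i k fy \<rho>y using True
            by (simp add: sq[symmetric] algebra_simps)
        next
          case False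
          then show ?thesis by (simp add: FS \<Phi>_def)
        qed
      qed
    qed measurable
    also have "\<dots> = of_real c * (\<integral>x. \<integral>s. \<Phi> x s \<partial>lborel \<partial>lborel) + (\<integral>x. of_real (C * (norm x powr (- \<alpha>) * (norm (F x))\<^sup>2 * \<rho>0 x)) \<partial>lborel)"
    proof -
      have i1: "integrable lborel (\<lambda>x. of_real c * (\<integral>s. \<Phi> x s \<partial>lborel))"
        by (intro integrable_mult_right lborel_pair.integrable_fst[OF \<Phi>_int])
      have i2: "integrable lborel (\<lambda>x. complex_of_real (C * (norm x powr (- \<alpha>) * (norm (F x))\<^sup>2 * \<rho>0 x)))"
        by (intro integrable_of_real integrable_mult_right intw)
      show ?thesis
        by (subst Bochner_Integration.integral_add[OF i1 i2]) (simp only: integral_mult_right_zero)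
    qed
    also have "(\<integral>x. complex_of_real (C * (norm x powr (- \<alpha>) * (norm (F x))\<^sup>2 * \<rho>0 x)) \<partial>lborel) = of_real (C * N)"
      unfolding integral_complex_of_real N_def by simp
    finally show ?thesis .
  qed
  have ca: "c / \<alpha> = 1 / Gamma (1 - \<alpha>)" using \<alpha> by (simp add: c_def)
  have "Re (weighted_inner \<Omega> \<rho> f (kipriyanov P \<alpha> f)) = c * Re (\<integral>x. \<integral>s. \<Phi> x s \<partial>lborel \<partial>lborel) + C * N"
    unfolding wi by simp
  moreover have "c * (- (fact (DIM('a) - 1) * Gamma (1 - \<alpha>) / (\<alpha> * Gamma (real DIM('a) - \<alpha>))) / 2 * N
        + D powr (- \<alpha>) / (2 * \<alpha>) * N1 - M * D powr (\<beta> - \<alpha>) / (2 * (\<beta> - \<alpha>)) * N0)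
      \<le> c * Re (\<integral>x. \<integral>s. \<Phi> x s \<partial>lborel \<partial>lborel)"
    using low c by (intro mult_left_mono) auto
  moreover have "c * (- (fact (DIM('a) - 1) * Gamma (1 - \<alpha>) / (\<alpha> * Gamma (real DIM('a) - \<alpha>))) / 2 * N
        + D powr (- \<alpha>) / (2 * \<alpha>) * N1 - M * D powr (\<beta> - \<alpha>) / (2 * (\<beta> - \<alpha>)) * N0)
     = - C / 2 * N + 1 / Gamma (1 - \<alpha>) / 2 * D powr (- \<alpha>) * N1 - c * D powr (\<beta> - \<alpha>) / (2 * (\<beta> - \<alpha>)) * (M * N0)"
    unfolding Bc[symmetric] ca[symmetric] by (simp add: algebra_simps)
  moreover have "c * D powr (\<beta> - \<alpha>) / (2 * (\<beta> - \<alpha>)) * (M * N0) \<le> c * D powr (\<beta> - \<alpha>) / (2 * (\<beta> - \<alpha>)) * (M / m * N1)"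
    using c \<beta> by (intro mult_left_mono N0N1) auto
  moreover have "C / 2 * (D powr (- \<alpha>) * N1) \<le> C / 2 * N"
    using C by (intro mult_left_mono N1N) auto
  ultimately have "C / 2 * (D powr (- \<alpha>) * N1) + 1 / Gamma (1 - \<alpha>) / 2 * D powr (- \<alpha>) * N1
      - c * D powr (\<beta> - \<alpha>) / (2 * (\<beta> - \<alpha>)) * (M / m * N1)
     \<le> Re (weighted_inner \<Omega> \<rho> f (kipriyanov P \<alpha> f))"
    by linarith
  also have "C / 2 * (D powr (- \<alpha>) * N1) + 1 / Gamma (1 - \<alpha>) / 2 * D powr (- \<alpha>) * N1
      - c * D powr (\<beta> - \<alpha>) / (2 * (\<beta> - \<alpha>)) * (M / m * N1)
    = (1 / 2 * D powr (- \<alpha>) * (1 / Gamma (1 - \<alpha>) + C)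
            - \<alpha> * M * D powr (\<beta> - \<alpha>) / (2 * Gamma (1 - \<alpha>) * (\<beta> - \<alpha>) * m)) * N1"
    using G0 \<beta> m by (simp add: c_def field_simps)
  finally show ?thesis unfolding wn D_def C_def .
qed

text \<open>Monotonicity is assumed on an interval that ends at \<open>ray_length\<close>, which is
  a measure; this shows that the interval reaches every point of the domain on the ray. By convexity
  the measured set contains the open interval from 0 to t.\<close>

lemma ray_length_ge:
  fixes \<Omega> :: "'a::euclidean_space set"
  assumes \<Omega>: "open \<Omega>" "convex \<Omega>" "bounded \<Omega>" and P: "P \<in> closure \<Omega>"
    and e: "norm e = 1" and t: "0 \<le> t" "P + t *\<^sub>R e \<in> \<Omega>"
  shows "t \<le> ray_length \<Omega> P e"
proof -
  let ?A = "{t. 0 \<le> t \<and> P + t *\<^sub>R e \<in> \<Omega>}"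
  have "{0<..<t} \<subseteq> ?A"
  proof
    fix \<tau> assume \<tau>: "\<tau> \<in> {0<..<t}"
    have "P + \<tau> *\<^sub>R e = (1 - \<tau> / t) *\<^sub>R P + (\<tau> / t) *\<^sub>R (P + t *\<^sub>R e)"
      using \<tau> by (simp add: algebra_simps)
    moreover have "P \<noteq> P + t *\<^sub>R e" using \<tau> e by auto
    ultimately have "P + \<tau> *\<^sub>R e \<in> open_segment P (P + t *\<^sub>R e)"
      using \<tau> by (auto simp: in_segment intro!: exI[of _ "\<tau> / t"])
    then show "\<tau> \<in> ?A"
      using in_interior_closure_convex_segment[OF \<Omega>(2), of "P + t *\<^sub>R e" P] t P \<Omega>(1) \<tau>
      by (auto simp: interior_open open_segment_commute)
  qed
  \<comment> \<open>Boundedness of the domain enters here: \<open>measure\<close> has the value 0 on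
    sets of infinite measure.\<close>
  moreover have "?A \<in> lmeasurable"
  proof (rule bounded_set_imp_lmeasurable)
    obtain B where B: "\<And>x. x \<in> \<Omega> \<Longrightarrow> norm x \<le> B" using \<Omega>(3) by (auto simp: bounded_iff)
    have "\<bar>\<tau>\<bar> \<le> B + norm P" if "\<tau> \<in> ?A" for \<tau>
    proof -
      have "\<bar>\<tau>\<bar> = norm ((P + \<tau> *\<^sub>R e) - P)" using e by simp
      also have "\<dots> \<le> norm (P + \<tau> *\<^sub>R e) + norm P" by (rule norm_triangle_ineq4)
      also have "\<dots> \<le> B + norm P" using B that by simp
      finally show ?thesis .
    qed
    then show "bounded ?A" unfolding bounded_iff real_norm_def by blast
    have "open ((\<lambda>t. P + t *\<^sub>R e) -` \<Omega>)"
      by (rule open_vimage[OF \<Omega>(1)]) (intro continuous_intros)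
    then have "{0..} \<inter> ((\<lambda>t. P + t *\<^sub>R e) -` \<Omega>) \<in> sets borel" by simp
    moreover have "?A = {0..} \<inter> ((\<lambda>t. P + t *\<^sub>R e) -` \<Omega>)" by auto
    ultimately show "?A \<in> sets lebesgue" by simp
  qed
  ultimately have "measure lebesgue {0<..<t} \<le> measure lebesgue ?A"
    by (intro measure_mono_fmeasurable) auto
  then show ?thesis using t by (simp add: ray_length_def)
qed

theorem theorem3p1:
  fixes \<Omega> :: "'a::euclidean_space set" and P :: 'a
    and \<alpha> \<beta> M :: real and \<rho> :: "'a \<Rightarrow> real"
  assumes "DIM('a) \<ge> 2"
    and "0 < \<alpha>" "\<alpha> < 1"
    and "open \<Omega>" "convex \<Omega>" "bounded \<Omega>" "\<Omega> \<noteq> {}"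
    and "P \<in> frontier \<Omega>"
    and "0 < \<beta>" "\<beta> \<le> 1" "\<alpha> < \<beta>"
    and "\<And>Q. Q \<in> closure \<Omega> \<Longrightarrow> 0 \<le> \<rho> Q"
    and "holder_with (closure \<Omega>) \<beta> M \<rho>"
  shows "((INF Q\<in>closure \<Omega>. \<rho> Q) > 0 \<longrightarrow>
           (\<forall>f\<in>H10 \<Omega>.
              Re (weighted_inner \<Omega> \<rho> f (kipriyanov P \<alpha> f))
              \<ge> (1 / 2 * diameter \<Omega> powr (- \<alpha>) * (1 / Gamma (1 - \<alpha>) + kipriyanov_const DIM('a) \<alpha>)
                   - \<alpha> * M * diameter \<Omega> powr (\<beta> - \<alpha>)
                     / (2 * Gamma (1 - \<alpha>) * (\<beta> - \<alpha>) * (INF Q\<in>closure \<Omega>. \<rho> Q)))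
                * (weighted_norm \<Omega> \<rho> f)\<^sup>2))
       \<and> ((\<forall>e. norm e = 1 \<longrightarrow> antimono_on {0..ray_length \<Omega> P e} (\<lambda>t. \<rho> (P + t *\<^sub>R e))) \<longrightarrow>
           (\<forall>f\<in>H10 \<Omega>.
              Re (weighted_inner \<Omega> \<rho> f (kipriyanov P \<alpha> f))
              \<ge> 1 / 2 * diameter \<Omega> powr (- \<alpha>) * (1 / Gamma (1 - \<alpha>) + kipriyanov_const DIM('a) \<alpha>)
                * (weighted_norm \<Omega> \<rho> f)\<^sup>2))"
proof (intro conjI impI ballI)
  have P: "P \<notin> \<Omega>" "P \<in> closure \<Omega>"
    using assms(4,8) by (auto simp: frontier_def interior_open)
  have cont: "continuous_on (closure \<Omega>) \<rho>"
    by (rule holder_with_continuous_on[OF assms(13,9)])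
  have cl: "Q \<in> closure \<Omega>" if "Q \<in> \<Omega>" for Q using that closure_subset by blast
  \<comment> \<open>The sign of the Hoelder constant is forced by the inequality between
    \<open>P\<close> and a point of the domain, which lies at positive distance from
    \<open>P\<close>.\<close>
  have M: "0 \<le> M"
  proof -
    obtain Q where Q: "Q \<in> \<Omega>" using assms(7) by auto
    have "0 \<le> \<bar>\<rho> P - \<rho> Q\<bar>" by simp
    also have "\<dots> \<le> M * dist P Q powr \<beta>"
      using assms(13) P(2) cl[OF Q] by (auto simp: holder_with_def)
    finally have "0 \<le> M * dist P Q powr \<beta>" .
    moreover have "0 < dist P Q powr \<beta>" using P(1) Q by auto
    ultimately show ?thesis by (simp add: zero_le_mult_iff)
  qed
  fix f assume f: "f \<in> H10 \<Omega>"
  {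
    assume m: "0 < (INF Q\<in>closure \<Omega>. \<rho> Q)"
    have "(INF Q\<in>closure \<Omega>. \<rho> Q) \<le> \<rho> Q" if "Q \<in> \<Omega>" for Q
      using assms(12) cl[OF that] by (intro cINF_lower bdd_belowI2[where m = 0])
    moreover have "\<rho> (P + y /\<^sub>R s) \<le> \<rho> (P + y) + M * (norm y * (1 - s) / s) powr \<beta>"
      if "P + y \<in> \<Omega>" "0 < s" "s < 1" "P + y /\<^sub>R s \<in> \<Omega>" for y s
    proof -
      \<comment> \<open>The dilation hypothesis is the Hoelder inequality for the points y and y/s,
        at distance |y| (1-s)/s from each other.\<close>
      have "y /\<^sub>R s - y = ((1 - s) / s) *\<^sub>R y"
        using that by (simp add: algebra_simps divide_inverse)
      then have "dist (P + y /\<^sub>R s) (P + y) = norm y * (1 - s) / s"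
        using that by (simp add: dist_norm)
      moreover have "\<bar>\<rho> (P + y /\<^sub>R s) - \<rho> (P + y)\<bar> \<le> M * dist (P + y /\<^sub>R s) (P + y) powr \<beta>"
        using assms(13) cl[OF that(1)] cl[OF that(4)] unfolding holder_with_def by blast
      ultimately show ?thesis by simp
    qed
    ultimately show "Re (weighted_inner \<Omega> \<rho> f (kipriyanov P \<alpha> f))
        \<ge> (1 / 2 * diameter \<Omega> powr (- \<alpha>) * (1 / Gamma (1 - \<alpha>) + kipriyanov_const DIM('a) \<alpha>)
             - \<alpha> * M * diameter \<Omega> powr (\<beta> - \<alpha>)
               / (2 * Gamma (1 - \<alpha>) * (\<beta> - \<alpha>) * (INF Q\<in>closure \<Omega>. \<rho> Q)))
          * (weighted_norm \<Omega> \<rho> f)\<^sup>2"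
      by (intro Re_weighted_inner_kipriyanov_ge assms cont M m f disjI2 ballI)
  }
  {
    assume mono: "\<forall>e. norm e = 1 \<longrightarrow> antimono_on {0..ray_length \<Omega> P e} (\<lambda>t. \<rho> (P + t *\<^sub>R e))"
    \<comment> \<open>The point y/s lies farther out on the same ray than y, so monotonicity is the
      dilation hypothesis without an error.\<close>
    have "\<rho> (P + y /\<^sub>R s) \<le> \<rho> (P + y) + 0 * (norm y * (1 - s) / s) powr \<beta>"
      if y: "P + y \<in> \<Omega>" and s: "0 < s" "s < 1" and ys: "P + y /\<^sub>R s \<in> \<Omega>" for y s
    proof -
      define e where "e = y /\<^sub>R norm y"
      have y0: "y \<noteq> 0" using P(1) y by auto
      have e: "norm e = 1" "norm y *\<^sub>R e = y" "(norm y / s) *\<^sub>R e = y /\<^sub>R s"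
        using y0 by (auto simp: e_def divide_inverse)
      have "norm y / s \<le> ray_length \<Omega> P e"
        using s ys e by (intro ray_length_ge assms P) auto
      moreover have "norm y \<le> norm y / s" using s by (simp add: field_simps mult_left_le_one_le)
      ultimately have "norm y \<in> {0..ray_length \<Omega> P e}" "norm y / s \<in> {0..ray_length \<Omega> P e}"
        using s by auto
      then have "\<rho> (P + (norm y / s) *\<^sub>R e) \<le> \<rho> (P + norm y *\<^sub>R e)"
        using mono e(1) \<open>norm y \<le> norm y / s\<close> unfolding monotone_on_def by blast
      then show ?thesis by (simp add: e)
    qed
    \<comment> \<open>The factor 0 is the value of \<open>M\<close>, and the final 1 stands in for
      the lower bound \<open>m\<close>, so this case does without a positive infimum.\<close>
    then have "(1 / 2 * diameter \<Omega> powr (- \<alpha>) * (1 / Gamma (1 - \<alpha>) + kipriyanov_const DIM('a) \<alpha>)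
             - \<alpha> * 0 * diameter \<Omega> powr (\<beta> - \<alpha>) / (2 * Gamma (1 - \<alpha>) * (\<beta> - \<alpha>) * 1))
          * (weighted_norm \<Omega> \<rho> f)\<^sup>2 \<le> Re (weighted_inner \<Omega> \<rho> f (kipriyanov P \<alpha> f))"
      by (intro Re_weighted_inner_kipriyanov_ge assms cont f disjI1) auto
    then show "Re (weighted_inner \<Omega> \<rho> f (kipriyanov P \<alpha> f))
        \<ge> 1 / 2 * diameter \<Omega> powr (- \<alpha>) * (1 / Gamma (1 - \<alpha>) + kipriyanov_const DIM('a) \<alpha>)
          * (weighted_norm \<Omega> \<rho> f)\<^sup>2" by simp
  }
qed

end
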